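(* Let $t>0$. Let $\mathrm{C}$ and $\mathrm{D}$ be generators of $C_0$-semigroups $\exp(s\mathrm{C})$ and $\exp(s\mathrm{D})$ in a Banach space $\mathbf{X}$. Assume that: (i) $\mathcal{D}(\mathrm{C})\cap\mathcal{D}(\mathrm{D})$ is dense in $\mathbf{X}$. (ii) There exist $a\in\mathbb{R}$ and $M\ge 1$ such that $\|\{\exp(\frac{s}{n}\mathrm{C})\exp(\frac{s}{n}\mathrm{D})\}^m\|\le M\exp(as\frac{m}{n})$ for all $n,m\in\mathbb{N}$, $s\ge 0$. Then the sum $\mathrm{C}+\mathrm{D}$ is a closable operator and its closure is a generator of a $C_0$-semigroup if and only if there exists a dense linear subspace $\mathbf{A}\subseteq\mathcal{D}(\mathrm{C})\cap\mathcal{D}(\mathrm{D})$ (dense in $\mathbf{X}$) such that for all $f\in\mathbf{A}$, $s\ge 0$ there exists a sequence $\{f_n^s\}_{n=1}^\infty$, $f_n^s\in\mathcal{D}(\mathrm{C})\cap\mathcal{D}(\mathrm{D})$, satisfying the following conditions: (a) $\lim_{n\to\infty}\|(\exp(\frac{t}{n}\mathrm{C})\exp(\frac{t}{n}\mathrm{D}))^{[ns]}f-f_n^s\|=0$; (b) the sets $\{f_n^s\}_{n=1}^\infty$ and $\{(\mathrm{C}+\mathrm{D})f_n^s\}_{n=1}^\infty$ are precompact. Furthermore, if conditions (a)–(b) are satisfied (for such $\mathbf{A}$ and sequences), then $$\exp(s(\overline{\mathrm{C}+\mathrm{D}}))f=\lim_{n\to\infty}\{\exp(\tfrac{s}{n}\mathrm{C})\exp(\tfrac{s}{n}\mathrm{D})\}^n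 f,\qquad s>0,$$ for all $f\in\mathbf{X}$.
   Context: The sum $\mathrm{C}+\mathrm{D}$ has domain $\mathcal{D}(\mathrm{C})\cap\mathcal{D}(\mathrm{D})$. $[x]$ is the integer part of $x$; precompact means relatively compact in the norm topology. *)

theory Defs
  imports "HOL-Analysis.Analysis"
begin

text \<open>
  A (possibly unbounded) operator in a Banach space is a partial function
  \<open>A :: 'a \<rightharpoonup> 'a\<close>; its domain is \<open>dom A\<close>, its graph is \<open>Map.graph A\<close>, and extension of
  operators is \<open>\<subseteq>\<^sub>m\<close>.
\<close>

text \<open>Linearity of the domain and of the operator on it amounts to the graph being a
  linear subspace of the product space.\<close>

definition linear_op :: "('a::real_vector \<rightharpoonup> 'a) \<Rightarrow> bool" where
  "linear_op A \<longleftrightarrow> subspace (Map.graph A)"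

definition op_add :: "('a::plus \<rightharpoonup> 'a) \<Rightarrow> ('a \<rightharpoonup> 'a) \<Rightarrow> ('a \<rightharpoonup> 'a)" where
  "op_add A B = (\<lambda>x. if x \<in> dom A \<inter> dom B then Some (the (A x) + the (B x)) else None)"

definition closable_op :: "('a::real_normed_vector \<rightharpoonup> 'a) \<Rightarrow> bool" where
  "closable_op A \<longleftrightarrow> (\<exists>B. linear_op B \<and> closed (Map.graph B) \<and> A \<subseteq>\<^sub>m B)"

text \<open>The operator whose graph is the closure of the graph of \<open>A\<close>; meaningful only for
  closable \<open>A\<close>.\<close>

definition closure_op :: "('a::real_normed_vector \<rightharpoonup> 'a) \<Rightarrow> ('a \<rightharpoonup> 'a)" where
  "closure_op A = (\<lambda>x. if \<exists>y. (x, y) \<in> closure (Map.graph A)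
                       then Some (THE y. (x, y) \<in> closure (Map.graph A)) else None)"

text \<open>Only the values \<open>T s\<close> for \<open>s \<ge> 0\<close> matter; those at negative times are unconstrained.\<close>

definition c0_semigroup :: "(real \<Rightarrow> 'a \<Rightarrow> 'a::real_normed_vector) \<Rightarrow> bool" where
  "c0_semigroup T \<longleftrightarrow>
     (\<forall>s\<ge>0. bounded_linear (T s)) \<and>
     T 0 = id \<and>
     (\<forall>r\<ge>0. \<forall>s\<ge>0. T (r + s) = T r \<circ> T s) \<and>
     (\<forall>x. ((\<lambda>s. T s x) \<longlongrightarrow> x) (at_right 0))"

definition generator :: "(real \<Rightarrow> 'a \<Rightarrow> 'a::real_normed_vector) \<Rightarrow> ('a \<rightharpoonup> 'a)" where
  "generator T = (\<lambda>x. if \<exists>y. ((\<lambda>h. (T h x - x) /\<^sub>R h) \<longlongrightarrow> y) (at_right 0)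
                      then Some (Lim (at_right 0) (\<lambda>h. (T h x - x) /\<^sub>R h)) else None)"

definition is_generator :: "('a::real_normed_vector \<rightharpoonup> 'a) \<Rightarrow> bool" where
  "is_generator A \<longleftrightarrow> (\<exists>T. c0_semigroup T \<and> generator T = A)"

text \<open>\<open>op_exp A s\<close> is the operator \<open>exp(s A)\<close>. In a Banach space a generator determines its
  semigroup at all times \<open>s \<ge> 0\<close>, so for such \<open>s\<close> the choice is immaterial.\<close>

definition op_exp :: "('a::real_normed_vector \<rightharpoonup> 'a) \<Rightarrow> real \<Rightarrow> 'a \<Rightarrow> 'a" where
  "op_exp A = (SOME T. c0_semigroup T \<and> generator T = A)"

definition precompact :: "'a::topological_space set \<Rightarrow> bool" where
  "precompact S \<longleftrightarrow> compact (closure S)"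

text \<open>The sequences \<open>g\<close> are indexed by \<open>n \<ge> 1\<close>; \<open>g 0\<close> is irrelevant.\<close>

definition approximating_subspace ::
    "real \<Rightarrow> ('a::banach \<rightharpoonup> 'a) \<Rightarrow> ('a \<rightharpoonup> 'a) \<Rightarrow> 'a set \<Rightarrow> bool" where
  "approximating_subspace t C D A \<longleftrightarrow>
     subspace A \<and> A \<subseteq> dom C \<inter> dom D \<and> closure A = UNIV \<and>
     (\<forall>f\<in>A. \<forall>s\<ge>0. \<exists>g :: nat \<Rightarrow> 'a.
        (\<forall>n\<ge>1. g n \<in> dom C \<inter> dom D) \<and>
        (\<lambda>n. norm (((op_exp C (t / real n) \<circ> op_exp D (t / real n)) ^^ nat \<lfloor>real n * s\<rfloor>) f - g n))
          \<longlonglongrightarrow> 0 \<and>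
        precompact (g ` {1..}) \<and>
        precompact ((\<lambda>n. the (op_add C D (g n))) ` {1..}))"

end

theory Submission
  imports Defs
begin

text \<open>
  Write \<open>F \<tau> = exp(\<tau>C) exp(\<tau>D)\<close> and \<open>L = C + D\<close>. If the closure of \<open>L\<close> generates a semigroup \<open>T\<close>,
  then \<open>F \<tau> ^^ m\<close> is close to \<open>T (m \<tau>)\<close> by telescoping over a bounded number of blocks, each short
  enough for both operators to move a vector \<open>y\<close> of the orbit by approximately the elapsed time
  multiplied by the value at \<open>y\<close> of the closure of \<open>L\<close>. This gives the product formula, and (b) is
  obtained by approximating the orbits \<open>T s f\<close> in the graph of \<open>L\<close>.

  Conversely, (a), (b) and stability make all sequences \<open>F (t/n) ^^ \<lfloor>ns\<rfloor> x\<close> precompact, so they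
  converge simultaneously along a suitable filter, and the limit is a semigroup whose generator \<open>G\<close>
  extends \<open>L\<close>. By (b) this semigroup maps \<open>A\<close> into the domain of the closure of \<open>L\<close>; Riemann sums
  of these orbits show that this domain is a core, so that \<open>G\<close> is the closure of \<open>L\<close>.
\<close>

text \<open>Neither integrals nor resolvents occur. Everything rests on one telescoping estimate,
  \<open>norm_funpow_diff_le\<close>, applied to the powers of \<open>F \<tau>\<close> and to those
  of \<open>T \<tau>\<close>; sums over short steps replace integrals of orbits. The obstacle to the
  product formula is uniformity, since consistency of \<open>F\<close> with \<open>L\<close> is only
  pointwise. For bounded times the pairs of orbit points and their images run through a compact part
  of the graph of the closure, so finitely many points of the graph of \<open>L\<close> control all
  starting points at once. The obstacle in the converse is that no limit semigroup is given.
  Precompactness yields only limit points, which may depend on the filter. Full convergence is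
  therefore not read off from this limit: it follows once the generator is known to be the closure
  of \<open>L\<close>, from the approximation theorem of the first direction. Moreover the limit
  semigroup is not known to map \<open>A\<close> into itself, only into the domain of the closure of
  \<open>L\<close>, so the core argument has to work with that domain.\<close>

section \<open>Uniform boundedness and the telescoping estimate\<close>

text \<open>Baire category: by pointwise boundedness the closed sets \<open>U k\<close> cover the
  space, so one of them contains a ball. Linearity and scaling turn the bound on this ball into a
  bound relative to the norm.\<close>

lemma uniform_boundedness:
  fixes f :: "'i::countable \<Rightarrow> 'a::banach \<Rightarrow> 'b::real_normed_vector"
  assumes lin: "\<And>i. bounded_linear (f i)"
    and bdd: "\<And>x. \<exists>B. \<forall>i. norm (f i x) \<le> B"
  shows "\<exists>K. \<forall>i x. norm (f i x) \<le> K * norm x"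
proof -
  define U where "U k = {x. \<forall>i. norm (f i x) \<le> real k}" for k :: nat
  have closed_U: "closed (U k)" for k
  proof -
    have "U k = (\<Inter>i. {x. norm (f i x) \<le> real k})"
      by (auto simp: U_def)
    moreover have "closed {x. norm (f i x) \<le> real k}" for i
      by (intro closed_Collect_le continuous_intros linear_continuous_on lin)
    ultimately show ?thesis by auto
  qed
  have "x \<in> \<Union> (range U)" for x
  proof -
    obtain B where B: "\<forall>i. norm (f i x) \<le> B" using bdd by blast
    have "x \<in> U (nat \<lceil>B\<rceil>)"
      unfolding U_def using B by (auto intro: order_trans[OF _ real_nat_ceiling_ge])
    then show ?thesis by blast
  qed
  then have cover: "\<Union> (range U) = UNIV" by blast
  have "\<exists>k. interior (U k) \<noteq> {}"
  proof (rule ccontr)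
    assume "\<not> ?thesis"
    then have "(euclidean :: 'a topology) interior_of \<Union> (range U) = {}"
      by (intro Baire_category_alt)
         (auto simp: completely_metrizable_space_euclidean closed_U)
    then show False by (simp add: cover)
  qed
  then obtain k x\<^sub>0 where "x\<^sub>0 \<in> interior (U k)" by blast
  then obtain r where r: "r > 0" "cball x\<^sub>0 r \<subseteq> U k"
    unfolding mem_interior_cball by blast
  have "norm (f i x) \<le> (2 * real k / r) * norm x" for i x
  proof (cases "x = 0")
    case True
    then show ?thesis using linear_simps(3)[OF lin] by simp
  next
    case False
    \<comment> \<open>Scaling x to length r keeps the shifted centre in the ball; taking the
      difference with the centre costs the factor 2 in the bound.\<close>
    define c where "c = r / norm x"
    have c: "c > 0" using r False by (simp add: c_def)
    have "dist x\<^sub>0 (x\<^sub>0 + c *\<^sub>R x) \<le> r"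
      using c r False by (simp add: dist_norm c_def)
    then have "x\<^sub>0 + c *\<^sub>R x \<in> U k" "x\<^sub>0 \<in> U k" using r by (auto simp: subset_iff)
    then have "norm (f i (x\<^sub>0 + c *\<^sub>R x)) \<le> k" "norm (f i x\<^sub>0) \<le> k"
      by (auto simp: U_def)
    moreover have "c *\<^sub>R f i x = f i (x\<^sub>0 + c *\<^sub>R x) - f i x\<^sub>0"
      by (simp add: linear_simps[OF lin])
    ultimately have "norm (c *\<^sub>R f i x) \<le> 2 * real k"
      using norm_triangle_ineq4[of "f i (x\<^sub>0 + c *\<^sub>R x)" "f i x\<^sub>0"] by simp
    then have "c * norm (f i x) \<le> 2 * real k" using c by simp
    then show ?thesis using c False r by (simp add: c_def field_simps)
  qed
  then show ?thesis by blast
qed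

lemma linear_funpow:
  fixes F :: "'a::real_vector \<Rightarrow> 'a"
  assumes "linear F"
  shows "linear (F ^^ k)"
proof (induction k)
  case 0
  show ?case by (rule linearI) auto
next
  case (Suc k)
  show ?case unfolding funpow.simps by (rule linear_compose[OF Suc assms])
qed

text \<open>F^k y - y is the sum of F^j (F y - y) over j < k. Replacing F y - y by \<tau> z costs
  \<open>K\<close> times the one-step error, and replacing F^j z by z costs \<omega>. Here z stands
  for the derivative at y; with z = 0 the estimate bounds the displacement of y.\<close>

lemma norm_funpow_diff_le:
  fixes F :: "'a::real_normed_vector \<Rightarrow> 'a"
  assumes F: "linear F" and \<tau>: "\<tau> \<ge> 0"
    and bound: "\<And>j x. j < k \<Longrightarrow> norm ((F ^^ j) x) \<le> K * norm x"
    and osc: "\<And>j. j < k \<Longrightarrow> norm ((F ^^ j) z - z) \<le> \<omega>"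
  shows "norm ((F ^^ k) y - y - (real k * \<tau>) *\<^sub>R z)
         \<le> real k * (K * norm (F y - y - \<tau> *\<^sub>R z) + \<tau> * \<omega>)"
  using bound osc
proof (induction k)
  case 0
  then show ?case by simp
next
  case (Suc k)
  have lin: "linear (F ^^ k)" using F by (rule linear_funpow)
  have "(F ^^ Suc k) y - y - (real (Suc k) * \<tau>) *\<^sub>R z
      = ((F ^^ k) y - y - (real k * \<tau>) *\<^sub>R z) + (F ^^ k) (F y - y - \<tau> *\<^sub>R z)
        + \<tau> *\<^sub>R ((F ^^ k) z - z)"
    by (simp only: funpow_Suc_right o_def linear_diff[OF lin] linear_scale[OF lin])
       (simp add: algebra_simps)
  moreover have "norm ((F ^^ k) (F y - y - \<tau> *\<^sub>R z)) \<le> K * norm (F y - y - \<tau> *\<^sub>R z)"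
    by (rule Suc.prems) simp
  moreover have "norm (\<tau> *\<^sub>R ((F ^^ k) z - z)) \<le> \<tau> * \<omega>"
    using Suc.prems(2)[of k] \<tau> by (simp add: mult_left_mono)
  moreover have "norm ((F ^^ k) y - y - (real k * \<tau>) *\<^sub>R z)
      \<le> real k * (K * norm (F y - y - \<tau> *\<^sub>R z) + \<tau> * \<omega>)"
    using Suc by simp
  ultimately have "norm ((F ^^ Suc k) y - y - (real (Suc k) * \<tau>) *\<^sub>R z)
      \<le> real k * (K * norm (F y - y - \<tau> *\<^sub>R z) + \<tau> * \<omega>)
         + K * norm (F y - y - \<tau> *\<^sub>R z) + \<tau> * \<omega>"
    by (smt (verit) norm_triangle_ineq)
  also have "\<dots> = real (Suc k) * (K * norm (F y - y - \<tau> *\<^sub>R z) + \<tau> * \<omega>)"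
    by (simp add: algebra_simps)
  finally show ?case .
qed

section \<open>Strongly continuous semigroups\<close>

lemma c0_semigroup_linear: "c0_semigroup T \<Longrightarrow> s \<ge> 0 \<Longrightarrow> bounded_linear (T s)"
  by (simp add: c0_semigroup_def)

lemma c0_semigroup_add: "c0_semigroup T \<Longrightarrow> r \<ge> 0 \<Longrightarrow> s \<ge> 0 \<Longrightarrow> T (r + s) x = T r (T s x)"
  by (simp add: c0_semigroup_def)

lemma c0_semigroup_zero: "c0_semigroup T \<Longrightarrow> T 0 x = x"
  by (simp add: c0_semigroup_def)

lemma c0_semigroup_tendsto: "c0_semigroup T \<Longrightarrow> ((\<lambda>s. T s x) \<longlongrightarrow> x) (at_right 0)"
  by (simp add: c0_semigroup_def)

lemma c0_semigroup_funpow: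
  assumes "c0_semigroup T" "h \<ge> 0"
  shows "(T h ^^ k) x = T (real k * h) x"
  using assms
  by (induction k)
     (simp_all add: c0_semigroup_zero c0_semigroup_add[symmetric] distrib_right)

text \<open>Otherwise there are times \<open>s n\<close> tending to 0 at which the operator norm
  exceeds n + 1, whereas \<open>T (s n) x\<close> converges to x for each x. This contradicts
  uniform boundedness.\<close>

lemma c0_semigroup_bounded_near_0:
  fixes T :: "real \<Rightarrow> 'a::banach \<Rightarrow> 'a"
  assumes T: "c0_semigroup T"
  shows "\<exists>\<delta>>0. \<exists>K\<ge>1. \<forall>s\<in>{0..\<delta>}. \<forall>x. norm (T s x) \<le> K * norm x"
proof (rule ccontr)
  assume "\<not> ?thesis"
  then have neg: "\<And>\<delta> K. \<delta> > 0 \<Longrightarrow> K \<ge> 1 \<Longrightarrow> \<exists>s\<in>{0..\<delta>}. \<exists>x. norm (T s x) > K * norm x"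
    by (meson not_le)
  have "\<exists>s\<in>{0..1 / real (Suc n)}. \<exists>x. norm (T s x) > real (Suc n) * norm x" for n
    by (intro neg) auto
  then obtain s where s: "\<And>n. s n \<in> {0..1 / real (Suc n)}"
    and s': "\<And>n. \<exists>x. norm (T (s n) x) > real (Suc n) * norm x"
    by metis
  have s0: "s \<longlonglongrightarrow> 0"
    by (rule real_tendsto_sandwich[of "\<lambda>_. 0", OF _ _ _ LIMSEQ_Suc[OF lim_1_over_n]])
       (use s in auto)
  \<comment> \<open>Strong continuity is stated along \<open>at_right 0\<close>, so the times must
    be nonzero; the identity at time 0 cannot exceed the factor \<open>Suc n\<close>.\<close>
  have pos: "s n > 0" for n
  proof (rule ccontr)
    assume "\<not> s n > 0"
    then have "s n = 0" using s[of n] by auto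
    then obtain x :: 'a where "norm x > real (Suc n) * norm x"
      using s'[of n] c0_semigroup_zero[OF T] by metis
    moreover have "norm x \<le> real (Suc n) * norm x"
      using mult_right_mono[of 1 "real (Suc n)" "norm x"] by simp
    ultimately show False by simp
  qed
  have at0: "filterlim s (at_right 0) sequentially"
    using s0 pos less_imp_neq[OF pos] by (force simp: filterlim_at intro!: always_eventually)
  have "\<exists>K. \<forall>n x. norm (T (s n) x) \<le> K * norm x"
  proof (rule uniform_boundedness)
    show "bounded_linear (T (s n))" for n
      using c0_semigroup_linear[OF T] pos[of n] by simp
    show "\<exists>B. \<forall>n. norm (T (s n) x) \<le> B" for x
    proof -
      have "(\<lambda>n. T (s n) x) \<longlonglongrightarrow> x"
        using filterlim_compose[OF c0_semigroup_tendsto[OF T] at0] .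
      then have "Bseq (\<lambda>n. T (s n) x)" by (rule convergent_imp_Bseq[OF convergentI])
      then show ?thesis by (auto simp: Bseq_def)
    qed
  qed
  then obtain K where K: "\<And>n x. norm (T (s n) x) \<le> K * norm x" by blast
  obtain n where n: "real n > K" using reals_Archimedean2 by blast
  obtain x where x: "norm (T (s n) x) > real (Suc n) * norm x" using s' by blast
  have "K * norm x \<le> real (Suc n) * norm x"
    using n by (intro mult_right_mono) auto
  with x K[of n x] show False by simp
qed

text \<open>Every time in [0, S] consists of \<open>N'\<close> equal steps of length at most
  \<delta>, with \<open>N'\<close> independent of the time, so the local bound \<open>K\<close>
  yields \<open>K ^ N'\<close>.\<close>

lemma c0_semigroup_bounded:
  fixes T :: "real \<Rightarrow> 'a::banach \<Rightarrow> 'a"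
  assumes T: "c0_semigroup T"
  shows "\<exists>K\<ge>1. \<forall>s\<in>{0..S}. \<forall>x. norm (T s x) \<le> K * norm x"
proof -
  obtain \<delta> K where \<delta>: "\<delta> > 0" "K \<ge> 1" and K: "\<And>s x. s \<in> {0..\<delta>} \<Longrightarrow> norm (T s x) \<le> K * norm x"
    using c0_semigroup_bounded_near_0[OF T] by metis
  obtain N where N: "real N > S / \<delta>" using reals_Archimedean2 by blast
  define N' where "N' = Suc N"
  have N': "N' > 0" "S / real N' \<le> \<delta>"
    using N \<delta> by (auto simp: N'_def field_simps)
  have "norm (T s x) \<le> K ^ N' * norm x" if s: "s \<in> {0..S}" for s x
  proof -
    have h: "s / real N' \<in> {0..\<delta>}" using s N' by (auto simp: field_simps)
    have "norm ((T (s / real N') ^^ k) x) \<le> K ^ k * norm x" for k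
    proof (induction k)
      case (Suc k)
      have "norm ((T (s / real N') ^^ Suc k) x) \<le> K * norm ((T (s / real N') ^^ k) x)"
        using K[OF h] by simp
      also have "\<dots> \<le> K * (K ^ k * norm x)"
        using Suc \<delta> by (intro mult_left_mono) auto
      finally show ?case by (simp add: mult.assoc)
    qed simp
    from this[of N'] show ?thesis
      using c0_semigroup_funpow[OF T, of "s / real N'" N' x] h N' by simp
  qed
  moreover have "K ^ N' \<ge> 1" using \<delta> by simp
  ultimately show ?thesis by blast
qed

lemma c0_semigroup_osc:
  fixes T :: "real \<Rightarrow> 'a::banach \<Rightarrow> 'a"
  assumes T: "c0_semigroup T" and e: "e > 0"
  shows "\<exists>\<delta>>0. \<forall>s\<in>{0..\<delta>}. norm (T s x - x) \<le> e"
proof -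
  have "eventually (\<lambda>s. dist (T s x) x < e) (at_right 0)"
    using c0_semigroup_tendsto[OF T] e by (rule tendstoD)
  then obtain b where b: "b > 0" "\<And>s. s > 0 \<Longrightarrow> s < b \<Longrightarrow> dist (T s x) x < e"
    by (auto simp: eventually_at_right_field)
  have "norm (T s x - x) \<le> e" if "s \<in> {0..b/2}" for s
    using b(2)[of s] that b(1) e c0_semigroup_zero[OF T, of x]
    by (cases "s = 0") (auto simp: dist_norm)
  with b(1) show ?thesis by (intro exI[of _ "b/2"]) auto
qed

text \<open>\<open>T s\<close> and \<open>T r\<close> commute, so the displacement at
  \<open>T r x\<close> is the image under \<open>T r\<close> of the displacement at x.\<close>

lemma c0_semigroup_osc_orbit:
  fixes T :: "real \<Rightarrow> 'a::banach \<Rightarrow> 'a"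
  assumes T: "c0_semigroup T" and e: "e > 0"
  shows "\<exists>\<delta>>0. \<forall>s\<in>{0..\<delta>}. \<forall>r\<in>{0..S}. norm (T s (T r x) - T r x) \<le> e"
proof -
  obtain K where K: "K \<ge> 1" "\<And>s x. s \<in> {0..S} \<Longrightarrow> norm (T s x) \<le> K * norm x"
    using c0_semigroup_bounded[OF T] by metis
  obtain \<delta> where \<delta>: "\<delta> > 0" "\<And>s. s \<in> {0..\<delta>} \<Longrightarrow> norm (T s x - x) \<le> e / K"
    using c0_semigroup_osc[OF T, of "e / K" x] e K by auto
  have "norm (T s (T r x) - T r x) \<le> e" if "s \<in> {0..\<delta>}" "r \<in> {0..S}" for s r
  proof -
    have "T s (T r x) - T r x = T r (T s x - x)"
      using that c0_semigroup_add[OF T, of s r x] c0_semigroup_add[OF T, of r s x]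
      by (simp add: linear_simps[OF c0_semigroup_linear[OF T]] add.commute)
    then have "norm (T s (T r x) - T r x) \<le> K * norm (T s x - x)"
      using K that by simp
    also have "\<dots> \<le> K * (e / K)"
      using \<delta> that K by (intro mult_left_mono) auto
    finally show ?thesis using K by simp
  qed
  with \<delta> show ?thesis by blast
qed

lemma c0_semigroup_continuous_on:
  fixes T :: "real \<Rightarrow> 'a::banach \<Rightarrow> 'a"
  assumes T: "c0_semigroup T"
  shows "continuous_on {0..S} (\<lambda>s. T s x)"
  unfolding continuous_on_iff
proof (intro ballI allI impI)
  fix s e :: real assume s: "s \<in> {0..S}" and e: "e > 0"
  obtain \<delta> where \<delta>: "\<delta> > 0"
    "\<And>h r. h \<in> {0..\<delta>} \<Longrightarrow> r \<in> {0..S} \<Longrightarrow> norm (T h (T r x) - T r x) \<le> e / 2"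
    using c0_semigroup_osc_orbit[OF T, of "e/2" S x] e by auto
  \<comment> \<open>Only forward displacements are estimated; taking the earlier of the two times as
    base point gives continuity from both sides.\<close>
  have le: "norm (T r' x - T r x) \<le> e / 2"
    if "r \<in> {0..S}" "r' \<in> {0..S}" "r \<le> r'" "r' - r \<le> \<delta>" for r r'
    using \<delta>(2)[of "r' - r" r] that c0_semigroup_add[OF T, of "r' - r" r x] by simp
  have "dist (T r x) (T s x) < e" if "r \<in> {0..S}" "dist r s < \<delta>" for r
    using le[of r s] le[of s r] that s e by (fastforce simp: dist_norm norm_minus_commute)
  with \<delta> show "\<exists>d>0. \<forall>r\<in>{0..S}. dist r s < d \<longrightarrow> dist (T r x) (T s x) < e" by blast
qed

section \<open>Generators and their graphs\<close>

lemma graph_generator: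
  "(x, z) \<in> Map.graph (generator T) \<longleftrightarrow> ((\<lambda>h. (T h x - x) /\<^sub>R h) \<longlongrightarrow> z) (at_right 0)"
proof -
  have "Lim (at_right (0::real)) f = y" if "(f \<longlongrightarrow> y) (at_right 0)" for f :: "real \<Rightarrow> 'a" and y
    using that by (intro tendsto_Lim) auto
  then show ?thesis
    by (auto simp: generator_def Map.graph_def split: if_splits)
qed

lemma linear_op_generator:
  assumes T: "c0_semigroup T"
  shows "linear_op (generator T)"
proof -
  note lin = linear_simps[OF c0_semigroup_linear[OF T]]
  have pos: "eventually (\<lambda>h::real. h \<ge> 0) (at_right 0)"
    by (rule eventually_mono[OF eventually_at_right_less]) simp
  show ?thesis
    unfolding linear_op_def subspace_def
  proof (intro conjI ballI allI; (clarsimp simp only: zero_prod_def add_Pair scaleR_Pair graph_generator)?)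
    show "((\<lambda>h. (T h 0 - 0) /\<^sub>R h) \<longlongrightarrow> 0) (at_right 0)"
      by (rule tendsto_eventually, rule eventually_mono[OF pos]) (simp add: lin)
  next
    fix x z y w
    assume "((\<lambda>h. (T h x - x) /\<^sub>R h) \<longlongrightarrow> z) (at_right 0)" "((\<lambda>h. (T h y - y) /\<^sub>R h) \<longlongrightarrow> w) (at_right 0)"
    from tendsto_add[OF this]
    show "((\<lambda>h. (T h (x + y) - (x + y)) /\<^sub>R h) \<longlongrightarrow> z + w) (at_right 0)"
      by (rule Lim_transform_eventually, intro eventually_mono[OF pos])
         (simp add: lin algebra_simps)
  next
    fix c x z
    assume "((\<lambda>h. (T h x - x) /\<^sub>R h) \<longlongrightarrow> z) (at_right 0)"
    from tendsto_scaleR[OF tendsto_const[of c] this]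
    show "((\<lambda>h. (T h (c *\<^sub>R x) - c *\<^sub>R x) /\<^sub>R h) \<longlongrightarrow> c *\<^sub>R z) (at_right 0)"
      by (rule Lim_transform_eventually, intro eventually_mono[OF pos])
         (simp add: lin algebra_simps)
  qed
qed

lemma generator_semigroup_invariant:
  assumes T: "c0_semigroup T" and "s \<ge> 0" and "(x, z) \<in> Map.graph (generator T)"
  shows "(T s x, T s z) \<in> Map.graph (generator T)"
proof -
  note lin = linear_simps[OF c0_semigroup_linear[OF T \<open>s \<ge> 0\<close>]]
  have pos: "eventually (\<lambda>h::real. h \<ge> 0) (at_right 0)"
    by (rule eventually_mono[OF eventually_at_right_less]) simp
  have "((\<lambda>h. T s ((T h x - x) /\<^sub>R h)) \<longlongrightarrow> T s z) (at_right 0)"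
    using assms by (intro bounded_linear.tendsto[OF c0_semigroup_linear[OF T]]) (auto simp: graph_generator)
  then show ?thesis
    unfolding graph_generator
  proof (rule Lim_transform_eventually)
    show "eventually (\<lambda>h. T s ((T h x - x) /\<^sub>R h) = (T h (T s x) - T s x) /\<^sub>R h) (at_right 0)"
      using pos
    proof eventually_elim
      case (elim h)
      then show ?case
        using c0_semigroup_add[OF T, of s h x] c0_semigroup_add[OF T, of h s x] \<open>s \<ge> 0\<close>
        by (simp add: lin add.commute)
    qed
  qed
qed

lemma filterlim_divide_Suc_at_right:
  assumes "c > 0"
  shows "filterlim (\<lambda>n. c / real (Suc n)) (at_right 0) sequentially"
  using assms LIMSEQ_Suc[OF lim_const_over_n[of c]]
  by (auto simp: filterlim_at)

text \<open>The discrete form of writing T h y - y as the integral of T s z over [0, h]: telescope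
  over n + 1 steps of length h / (n + 1). The one-step error is the step times the defect of a
  difference quotient, which vanishes as n grows, so only the oscillation of T s z remains.\<close>

lemma generator_difference_le:
  fixes T :: "real \<Rightarrow> 'a::banach \<Rightarrow> 'a"
  assumes T: "c0_semigroup T" and yz: "(y, z) \<in> Map.graph (generator T)" and h: "h \<ge> 0"
    and osc: "\<And>s. s \<in> {0..h} \<Longrightarrow> norm (T s z - z) \<le> \<omega>"
  shows "norm (T h y - y - h *\<^sub>R z) \<le> h * \<omega>"
proof (cases "h = 0")
  case True
  then show ?thesis using c0_semigroup_zero[OF T] by simp
next
  case False
  then have h: "h > 0" using h by simp
  obtain K where K: "K \<ge> 1" "\<And>s x. s \<in> {0..h} \<Longrightarrow> norm (T s x) \<le> K * norm x"
    using c0_semigroup_bounded[OF T] by metis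
  define \<tau> where "\<tau> n = h / real (Suc n)" for n
  have \<tau>: "\<tau> n > 0" "real (Suc n) * \<tau> n = h" for n using h by (auto simp: \<tau>_def)
  have small: "real j * \<tau> n \<in> {0..h}" if "j < Suc n" for j n
    using that \<tau>[of n] mult_right_mono[of "real j" "real (Suc n)" "\<tau> n"] by simp
  have "norm (T h y - y - h *\<^sub>R z) \<le> h * (K * norm ((T (\<tau> n) y - y) /\<^sub>R \<tau> n - z) + \<omega>)" for n
  proof -
    have "norm ((T (\<tau> n) ^^ Suc n) y - y - (real (Suc n) * \<tau> n) *\<^sub>R z)
        \<le> real (Suc n) * (K * norm (T (\<tau> n) y - y - \<tau> n *\<^sub>R z) + \<tau> n * \<omega>)"
      using \<tau>(1)[of n] small K(2) osc
      by (intro norm_funpow_diff_le bounded_linear.linear[OF c0_semigroup_linear[OF T]])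
         (auto simp: c0_semigroup_funpow[OF T])
    moreover have "(T (\<tau> n) ^^ Suc n) y = T h y"
      using c0_semigroup_funpow[OF T, of "\<tau> n" "Suc n"] \<tau>[of n] by simp
    moreover have "T (\<tau> n) y - y - \<tau> n *\<^sub>R z = \<tau> n *\<^sub>R ((T (\<tau> n) y - y) /\<^sub>R \<tau> n - z)"
      using \<tau>(1)[of n] by (simp add: algebra_simps)
    ultimately have "norm (T h y - y - h *\<^sub>R z)
        \<le> real (Suc n) * (K * (\<tau> n * norm ((T (\<tau> n) y - y) /\<^sub>R \<tau> n - z)) + \<tau> n * \<omega>)"
      using \<tau>[of n] by simp
    also have "\<dots> = (real (Suc n) * \<tau> n) * (K * norm ((T (\<tau> n) y - y) /\<^sub>R \<tau> n - z) + \<omega>)"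
      by (simp add: algebra_simps)
    finally show ?thesis using \<tau>(2)[of n] by simp
  qed
  moreover have "(\<lambda>n. h * (K * norm ((T (\<tau> n) y - y) /\<^sub>R \<tau> n - z) + \<omega>))
      \<longlonglongrightarrow> h * (K * norm (z - z) + \<omega>)"
    unfolding \<tau>_def
    using yz by (intro tendsto_intros filterlim_compose[OF _ filterlim_divide_Suc_at_right[OF h]])
                (simp add: graph_generator)
  ultimately have "norm (T h y - y - h *\<^sub>R z) \<le> h * (K * norm (z - z) + \<omega>)"
    by (intro LIMSEQ_le_const) auto
  then show ?thesis by simp
qed

text \<open>A converse of the preceding estimate. For fixed h the inequality is stable under limits
  in y, z and T, which is how closedness and the extension property are obtained.\<close>

lemma generatorI_difference_le:
  assumes "\<And>e. e > 0 \<Longrightarrow> \<exists>\<delta>>0. \<forall>h\<in>{0<..\<delta>}. norm (T h y - y - h *\<^sub>R z) \<le> h * e"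
  shows "(y, z) \<in> Map.graph (generator T)"
  unfolding graph_generator
proof (rule tendstoI)
  fix e :: real assume e: "e > 0"
  obtain \<delta> where \<delta>: "\<delta> > 0" "\<And>h. h \<in> {0<..\<delta>} \<Longrightarrow> norm (T h y - y - h *\<^sub>R z) \<le> h * (e/2)"
    using assms[of "e/2"] e by auto
  show "eventually (\<lambda>h. dist ((T h y - y) /\<^sub>R h) z < e) (at_right 0)"
    unfolding eventually_at_right_field
  proof (intro exI[of _ \<delta>] conjI allI impI \<delta>(1))
    fix h assume h: "0 < h" "h < \<delta>"
    have "(T h y - y) /\<^sub>R h - z = (T h y - y - h *\<^sub>R z) /\<^sub>R h"
      using h by (simp add: algebra_simps)
    then have "norm ((T h y - y) /\<^sub>R h - z) = norm (T h y - y - h *\<^sub>R z) / h"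
      using h by (simp add: divide_inverse mult.commute)
    also have "\<dots> \<le> e / 2" using \<delta>(2)[of h] h by (simp add: field_simps)
    finally show "dist ((T h y - y) /\<^sub>R h) z < e" using e by (simp add: dist_norm)
  qed
qed

text \<open>For fixed h the estimate \<open>generator_difference_le\<close> passes to the limit. The
  oscillation of \<open>v n\<close> exceeds that of z by at most (K + 1) times their
  distance.\<close>

lemma closed_graph_generator:
  fixes T :: "real \<Rightarrow> 'a::banach \<Rightarrow> 'a"
  assumes T: "c0_semigroup T"
  shows "closed (Map.graph (generator T))"
  unfolding closed_sequential_limits
proof (intro allI impI; elim conjE)
  fix p l assume p: "\<forall>n. p n \<in> Map.graph (generator T)" and lim: "p \<longlonglongrightarrow> l"
  obtain y z where l: "l = (y, z)" by (cases l)
  define u v where "u = fst \<circ> p" and "v = snd \<circ> p"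
  then have uv: "p n = (u n, v n)" for n by simp
  have u: "u \<longlonglongrightarrow> y" and v: "v \<longlonglongrightarrow> z"
    using tendsto_fst[OF lim] tendsto_snd[OF lim] by (simp_all add: uv l)
  have "(y, z) \<in> Map.graph (generator T)"
  proof (rule generatorI_difference_le)
    fix e :: real assume e: "e > 0"
    obtain \<delta> where \<delta>: "\<delta> > 0" "\<And>s. s \<in> {0..\<delta>} \<Longrightarrow> norm (T s z - z) \<le> e"
      using c0_semigroup_osc[OF T e] by metis
    obtain K where K: "K \<ge> 1" "\<And>s x. s \<in> {0..\<delta>} \<Longrightarrow> norm (T s x) \<le> K * norm x"
      using c0_semigroup_bounded[OF T] by metis
    have "norm (T h y - y - h *\<^sub>R z) \<le> h * e" if h: "h \<in> {0<..\<delta>}" for h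
    proof -
      have "norm (T h (u n) - u n - h *\<^sub>R v n) \<le> h * (e + (K + 1) * norm (v n - z))" for n
      proof (rule generator_difference_le[OF T])
        show "(u n, v n) \<in> Map.graph (generator T)" using p uv by metis
        fix s assume s: "s \<in> {0..h}"
        have "T s (v n) - v n = (T s z - z) + T s (v n - z) - (v n - z)"
          using s by (simp add: linear_simps[OF c0_semigroup_linear[OF T]])
        then have "norm (T s (v n) - v n) \<le> norm (T s z - z) + norm (T s (v n - z)) + norm (v n - z)"
          by (smt (verit) norm_triangle_ineq norm_triangle_ineq4)
        also have "\<dots> \<le> e + K * norm (v n - z) + norm (v n - z)"
          using \<delta>(2)[of s] K(2)[of s "v n - z"] s h by simp
        finally show "norm (T s (v n) - v n) \<le> e + (K + 1) * norm (v n - z)"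
          by (simp add: algebra_simps)
      qed (use h in auto)
      moreover have "(\<lambda>n. h * (e + (K + 1) * norm (v n - z))) \<longlonglongrightarrow> h * (e + (K + 1) * norm (z - z))"
        by (intro tendsto_intros v)
      moreover have "(\<lambda>n. norm (T h (u n) - u n - h *\<^sub>R v n)) \<longlonglongrightarrow> norm (T h y - y - h *\<^sub>R z)"
        using h by (intro tendsto_intros u v bounded_linear.tendsto[OF c0_semigroup_linear[OF T]]) auto
      ultimately have "norm (T h y - y - h *\<^sub>R z) \<le> h * (e + (K + 1) * norm (z - z))"
        by (intro LIMSEQ_le) auto
      then show ?thesis by simp
    qed
    with \<delta> show "\<exists>\<delta>>0. \<forall>h\<in>{0<..\<delta>}. norm (T h y - y - h *\<^sub>R z) \<le> h * e" by blast
  qed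
  then show "l \<in> Map.graph (generator T)" by (simp add: l)
qed

text \<open>Density provides a in \<open>A\<close> close to x, but b may be far from z. Averaging
  cures this: h times the mean of T s b over [0, h] is nearly T h a - a, where b no longer occurs
  and a may be replaced by x. Riemann means of pairs stay in \<open>P\<close> because it is a
  subspace.\<close>

lemma generator_subset_closed_subspace:
  fixes T :: "real \<Rightarrow> 'a::banach \<Rightarrow> 'a"
  assumes T: "c0_semigroup T" and P: "subspace P" "closed P" and A: "closure A = UNIV"
    and orbit: "\<And>a. a \<in> A \<Longrightarrow> \<exists>b. (a, b) \<in> Map.graph (generator T) \<and> (\<forall>s\<ge>0. (T s a, T s b) \<in> P)"
  shows "Map.graph (generator T) \<subseteq> P"
proof (rule subrelI)
  fix x z assume xz: "(x, z) \<in> Map.graph (generator T)"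
  have "\<exists>p\<in>P. dist p (x, z) < e" if e: "e > 0" for e
  proof -
    have e8: "e / 8 > 0" using e by simp
    obtain \<delta>\<^sub>1 where \<delta>\<^sub>1: "\<delta>\<^sub>1 > 0" "\<And>s. s \<in> {0..\<delta>\<^sub>1} \<Longrightarrow> norm (T s x - x) \<le> e / 8"
      using c0_semigroup_osc[OF T e8] by metis
    obtain \<delta>\<^sub>2 where \<delta>\<^sub>2: "\<delta>\<^sub>2 > 0" "\<And>s. s \<in> {0..\<delta>\<^sub>2} \<Longrightarrow> norm (T s z - z) \<le> e / 8"
      using c0_semigroup_osc[OF T e8] by metis
    \<comment> \<open>The order of choices matters: h depends on x and z, then a is chosen close to
      x relative to h, then the number of steps depends on a and b.\<close>
    define h where "h = min \<delta>\<^sub>1 \<delta>\<^sub>2"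
    have h: "h > 0" using \<delta>\<^sub>1 \<delta>\<^sub>2 by (simp add: h_def)
    have Thx: "norm (T h x - x - h *\<^sub>R z) \<le> h * (e / 8)"
      using \<delta>\<^sub>2 h by (intro generator_difference_le[OF T xz]) (auto simp: h_def)
    obtain K where K: "K \<ge> 1" "\<And>s x. s \<in> {0..h} \<Longrightarrow> norm (T s x) \<le> K * norm x"
      using c0_semigroup_bounded[OF T] by metis
    \<comment> \<open>The factor \<open>min 1 h\<close> is there because the error of a gets divided
      by h when \<open>R b\<close> is compared with z; K + 1 accounts for a - x together with its
      image under \<open>T h\<close>.\<close>
    define \<eta> where "\<eta> = min 1 h * (e / 8) / (K + 1)"
    have \<eta>: "\<eta> > 0" using h e K by (simp add: \<eta>_def)
    have "(K + 1) * \<eta> = min 1 h * (e / 8)"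
      using K(1) unfolding \<eta>_def by (intro nonzero_mult_div_cancel_left[THEN trans[OF times_divide_eq_right]]) simp
    moreover have "min 1 h * (e / 8) \<le> 1 * (e / 8)" "min 1 h * (e / 8) \<le> h * (e / 8)"
      using e by (intro mult_right_mono; simp)+
    ultimately have \<eta>': "(K + 1) * \<eta> \<le> e / 8" "(K + 1) * \<eta> \<le> h * (e / 8)" by simp_all
    have "x \<in> closure A" using A by simp
    then obtain a where a: "a \<in> A" "dist a x < \<eta>"
      using \<eta> by (meson closure_approachable)
    obtain b where ab: "(a, b) \<in> Map.graph (generator T)"
      and inP: "\<And>s. s \<ge> 0 \<Longrightarrow> (T s a, T s b) \<in> P"
      using orbit[OF a(1)] by blast
    have "eventually (\<lambda>\<tau>. dist ((T \<tau> a - a) /\<^sub>R \<tau>) b < e / (8 * K)) (at_right 0)"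
      using ab e K by (intro tendstoD) (auto simp: graph_generator)
    from eventually_compose_filterlim[OF this filterlim_divide_Suc_at_right[OF h]]
    obtain n where n: "dist ((T (h / Suc n) a - a) /\<^sub>R (h / Suc n)) b < e / (8 * K)"
      unfolding eventually_sequentially by blast
    define N where "N = Suc n"
    define \<tau> where "\<tau> = h / N"
    have \<tau>: "\<tau> > 0" "real N * \<tau> = h" using h by (auto simp: \<tau>_def N_def)
    have N: "real N > 0" by (simp add: N_def)
    have k\<tau>: "real k * \<tau> \<in> {0..h}" if "k < N" for k
      using that \<tau> mult_right_mono[of "real k" "real N" \<tau>] by simp
    define R where "R w = (1 / real N) *\<^sub>R (\<Sum>k<N. T (real k * \<tau>) w)" for w
    have R_minus: "R w - v = (1 / real N) *\<^sub>R (\<Sum>k<N. T (real k * \<tau>) w - v)" for w v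
      using N by (simp add: R_def sum_subtractf scaleR_diff_right sum_constant_scaleR)
    have "(R a, R b) = (1 / real N) *\<^sub>R (\<Sum>k<N. (T (real k * \<tau>) a, T (real k * \<tau>) b))"
      by (simp add: R_def sum_prod)
    also have "\<dots> \<in> P"
      using \<tau> by (intro subspace_scale subspace_sum P(1) inP) auto
    finally have RP: "(R a, R b) \<in> P" .
    have "norm (R a - x) \<le> e / 4"
    proof -
      have "norm (\<Sum>k<N. T (real k * \<tau>) a - x) \<le> real (card {..<N}) * (e / 4)"
      proof (rule sum_norm_bound)
        fix k assume k: "k \<in> {..<N}"
        have "T (real k * \<tau>) a - x = T (real k * \<tau>) (a - x) + (T (real k * \<tau>) x - x)"
          using \<tau> by (simp add: linear_simps[OF c0_semigroup_linear[OF T]])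
        then have "norm (T (real k * \<tau>) a - x)
            \<le> norm (T (real k * \<tau>) (a - x)) + norm (T (real k * \<tau>) x - x)"
          by (metis norm_triangle_ineq)
        also have "\<dots> \<le> K * norm (a - x) + e / 8"
          using k\<tau>[of k] k by (intro add_mono K \<delta>\<^sub>1) (auto simp: h_def)
        also have "K * norm (a - x) \<le> (K + 1) * \<eta>"
          using a K \<eta> by (intro mult_mono) (auto simp: dist_norm)
        finally show "norm (T (real k * \<tau>) a - x) \<le> e / 4" using \<eta>' by simp
      qed
      then show ?thesis using N by (simp add: R_minus field_simps)
    qed
    moreover have "norm (R b - z) \<le> 3 * e / 8"
    proof -
      have step: "norm (T (real k * \<tau>) (T \<tau> a - a - \<tau> *\<^sub>R b)) \<le> \<tau> * (e / 8)" if "k < N" for k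
      proof -
        have "T \<tau> a - a - \<tau> *\<^sub>R b = \<tau> *\<^sub>R ((T \<tau> a - a) /\<^sub>R \<tau> - b)"
          using \<tau> by (simp add: scaleR_diff_right)
        then have eq: "norm (T \<tau> a - a - \<tau> *\<^sub>R b) = \<tau> * norm ((T \<tau> a - a) /\<^sub>R \<tau> - b)"
          using \<tau>(1) by simp
        have "norm (T (real k * \<tau>) (T \<tau> a - a - \<tau> *\<^sub>R b)) \<le> K * norm (T \<tau> a - a - \<tau> *\<^sub>R b)"
          by (intro K k\<tau> that)
        also note eq
        also have "K * (\<tau> * norm ((T \<tau> a - a) /\<^sub>R \<tau> - b)) \<le> K * (\<tau> * (e / (8 * K)))"
          using n[folded N_def, folded \<tau>_def, unfolded dist_norm] \<tau>(1) K(1)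
          by (intro mult_left_mono) auto
        finally show ?thesis using K by simp
      qed
      \<comment> \<open>Each summand is an increment of the orbit of a minus \<tau> times a term of
        the Riemann sum of b. The increments telescope, which ties \<open>R b\<close> to
        \<open>T h a - a\<close>.\<close>
      have "(\<Sum>k<N. T (real k * \<tau>) (T \<tau> a - a - \<tau> *\<^sub>R b))
          = (\<Sum>k<N. (T (real (Suc k) * \<tau>) a - T (real k * \<tau>) a) - \<tau> *\<^sub>R T (real k * \<tau>) b)"
      proof (rule sum.cong[OF refl])
        fix k
        have "T (real k * \<tau> + \<tau>) a = T (real k * \<tau>) (T \<tau> a)"
          using \<tau> by (intro c0_semigroup_add[OF T]) auto
        then show "T (real k * \<tau>) (T \<tau> a - a - \<tau> *\<^sub>R b)
            = (T (real (Suc k) * \<tau>) a - T (real k * \<tau>) a) - \<tau> *\<^sub>R T (real k * \<tau>) b"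
          using \<tau> by (simp add: linear_simps[OF c0_semigroup_linear[OF T]] distrib_right add.commute)
      qed
      also have "\<dots> = (\<Sum>k<N. T (real (Suc k) * \<tau>) a - T (real k * \<tau>) a)
          - (\<Sum>k<N. \<tau> *\<^sub>R T (real k * \<tau>) b)"
        by (rule sum_subtractf)
      also have "(\<Sum>k<N. T (real (Suc k) * \<tau>) a - T (real k * \<tau>) a)
          = T (real N * \<tau>) a - T (real 0 * \<tau>) a"
        by (rule sum_lessThan_telescope)
      also have "T (real N * \<tau>) a - T (real 0 * \<tau>) a - (\<Sum>k<N. \<tau> *\<^sub>R T (real k * \<tau>) b) = T h a - a - \<tau> *\<^sub>R (real N *\<^sub>R R b)"
        using N \<tau> by (simp add: c0_semigroup_zero[OF T] scaleR_sum_right R_def)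
      also have "\<dots> = T h a - a - h *\<^sub>R R b"
        using \<tau> by (simp add: mult.commute)
      finally have "norm (T h a - a - h *\<^sub>R R b)
          = norm (\<Sum>k<N. T (real k * \<tau>) (T \<tau> a - a - \<tau> *\<^sub>R b))" by simp
      also have "\<dots> \<le> real (card {..<N}) * (\<tau> * (e / 8))"
        by (rule sum_norm_bound, rule step) simp
      also have "\<dots> = h * (e / 8)" using \<tau>(2)[symmetric] by simp
      finally have 1: "norm (T h a - a - h *\<^sub>R R b) \<le> h * (e / 8)" .
      have "norm (T h (a - x)) \<le> K * norm (a - x)" using h by (intro K) auto
      then have "norm (T h (a - x)) + norm (a - x) \<le> (K + 1) * norm (a - x)"
        by (simp add: distrib_right)
      also have "\<dots> \<le> (K + 1) * \<eta>"
        using a K by (intro mult_left_mono) (auto simp: dist_norm)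
      finally have 2: "norm (T h (a - x)) + norm (a - x) \<le> h * (e / 8)" using \<eta>' by simp
      have "h *\<^sub>R (R b - z) = T h (a - x) - (a - x) + (T h x - x - h *\<^sub>R z) - (T h a - a - h *\<^sub>R R b)"
        using h by (simp add: linear_simps[OF c0_semigroup_linear[OF T]] scaleR_diff_right)
      then have "norm (h *\<^sub>R (R b - z)) \<le> norm (T h (a - x)) + norm (a - x)
          + norm (T h x - x - h *\<^sub>R z) + norm (T h a - a - h *\<^sub>R R b)"
        by (smt (verit) norm_triangle_ineq norm_triangle_ineq4)
      moreover have "norm (h *\<^sub>R (R b - z)) = h * norm (R b - z)" using h by simp
      moreover have "h * (3 * e / 8) = 3 * (h * (e / 8))" by simp
      ultimately have "h * norm (R b - z) \<le> h * (3 * e / 8)"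
        using 1 2 Thx by linarith
      then show ?thesis using h by simp
    qed
    moreover have "dist (R a, R b) (x, z) \<le> norm (R a - x) + norm (R b - z)"
      using norm_Pair_le[of "R a - x" "R b - z"] by (simp add: dist_norm)
    ultimately have "dist (R a, R b) (x, z) < e" using e by simp
    with RP show ?thesis by blast
  qed
  then have "(x, z) \<in> closure P" by (auto simp: closure_approachable)
  then show "(x, z) \<in> P" using P(2) by simp
qed

section \<open>Chernoff approximation\<close>

text \<open>An abstraction of the product of the two semigroups: the derivative of \<open>F\<close>
  at 0 extends \<open>L\<close>. Asking for stability on bounded times only absorbs exponential
  growth into the constant.\<close>

locale chernoff_family =
  fixes F :: "real \<Rightarrow> 'a::banach \<Rightarrow> 'a" and L :: "'a \<rightharpoonup> 'a"
  assumes linear_F: "\<tau> \<ge> 0 \<Longrightarrow> bounded_linear (F \<tau>)"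
    and stable: "\<exists>K\<ge>1. \<forall>\<tau>\<ge>0. \<forall>m x. real m * \<tau> \<le> S \<longrightarrow> norm ((F \<tau> ^^ m) x) \<le> K * norm x"
    and dense_dom: "closure (dom L) = UNIV"
    and consistent: "(y, z) \<in> Map.graph L \<Longrightarrow> ((\<lambda>\<tau>. (F \<tau> y - y) /\<^sub>R \<tau>) \<longlongrightarrow> z) (at_right 0)"
begin

lemma linear_F_funpow: "\<tau> \<ge> 0 \<Longrightarrow> linear (F \<tau> ^^ m)"
  by (intro linear_funpow bounded_linear.linear[OF linear_F])

text \<open>At points y of the domain of \<open>L\<close> the difference quotients stay bounded, so
  F^m y - y is of order m \<tau>. Finitely many such points approximate the compact set, and
  stability carries the estimate over to the rest.\<close>

lemma uniform_osc:
  assumes Z: "compact Z" and e: "e > 0"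
  shows "\<exists>d>0. eventually (\<lambda>\<tau>. \<forall>m. real m * \<tau> \<le> d \<longrightarrow> (\<forall>z\<in>Z. norm ((F \<tau> ^^ m) z - z) \<le> e)) (at_right 0)"
proof -
  obtain K where K: "K \<ge> 1"
    "\<And>\<tau> m x. \<tau> \<ge> 0 \<Longrightarrow> real m * \<tau> \<le> 1 \<Longrightarrow> norm ((F \<tau> ^^ m) x) \<le> K * norm x"
    using stable[of 1] by metis
  define \<eta> where "\<eta> = e / (2 * (K + 1))"
  have \<eta>: "\<eta> > 0" "(K + 1) * \<eta> = e / 2" using e K by (auto simp: \<eta>_def field_simps)
  have "Z \<subseteq> (\<Union>y\<in>dom L. ball y \<eta>)"
  proof
    fix z
    have "z \<in> closure (dom L)" using dense_dom by simp
    then show "z \<in> (\<Union>y\<in>dom L. ball y \<eta>)"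
      using \<eta> by (auto simp: closure_approachable)
  qed
  then obtain W where W: "W \<subseteq> dom L" "finite W" "Z \<subseteq> (\<Union>y\<in>W. ball y \<eta>)"
    using compactE_image[OF Z, of "dom L" "\<lambda>y. ball y \<eta>"] by auto
  \<comment> \<open>The summand 1 makes the bound on the finitely many derivatives strict, so that
    the difference quotients eventually satisfy it too.\<close>
  define B where "B = 1 + (\<Sum>y\<in>W. norm (the (L y)))"
  have B: "norm (the (L y)) < B" if "y \<in> W" for y
    using member_le_sum[OF that, of "\<lambda>y. norm (the (L y))"] W by (simp add: B_def)
  have "B > 0" using sum_nonneg[of W "\<lambda>y. norm (the (L y))"] by (simp add: B_def)
  \<comment> \<open>A displacement at speed K * B during time d is at most e / 2.\<close>
  define d where "d = min 1 (e / (2 * K * B))"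
  have d: "d > 0" "d \<le> 1" "d \<le> e / (2 * K * B)" using e K \<open>B > 0\<close> by (auto simp: d_def)
  have "d * (K * B) \<le> e / 2" using d(3) K \<open>B > 0\<close> by (simp add: field_simps)
  have "eventually (\<lambda>\<tau>. norm ((F \<tau> y - y) /\<^sub>R \<tau>) < B) (at_right 0)" if "y \<in> W" for y
  proof -
    have "(y, the (L y)) \<in> Map.graph L" using that W by (auto simp: Map.graph_def)
    from tendsto_norm[OF consistent[OF this]] show ?thesis
      using B[OF that] by (rule order_tendstoD(2))
  qed
  then have "eventually (\<lambda>\<tau>. \<forall>y\<in>W. norm ((F \<tau> y - y) /\<^sub>R \<tau>) < B) (at_right 0)"
    using W(2) by (intro eventually_ball_finite) auto
  then have "eventually (\<lambda>\<tau>. \<forall>m. real m * \<tau> \<le> d \<longrightarrow> (\<forall>z\<in>Z. norm ((F \<tau> ^^ m) z - z) \<le> e)) (at_right 0)"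
    using eventually_at_right_less
  proof eventually_elim
    case (elim \<tau>)
    show ?case
    proof (intro allI impI ballI)
      fix m z assume m: "real m * \<tau> \<le> d" and z: "z \<in> Z"
      obtain y where y: "y \<in> W" "norm (y - z) < \<eta>"
        using W(3) z by (auto simp: dist_norm)
      have bnd: "norm ((F \<tau> ^^ j) x) \<le> K * norm x" if "j \<le> m" for j x
        using that elim(2) m d(2)
        by (intro K order_trans[OF mult_right_mono[of "real j" "real m" \<tau>]]) auto
      have lin: "linear (F \<tau> ^^ j)" for j using elim(2) by (intro linear_F_funpow) simp
      have "norm ((F \<tau> ^^ m) y - y - (real m * \<tau>) *\<^sub>R 0)
          \<le> real m * (K * norm (F \<tau> y - y - \<tau> *\<^sub>R 0) + \<tau> * 0)"
        using lin[of 1] elim(2) bnd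
        by (intro norm_funpow_diff_le) (auto simp: linear_0[OF lin])
      also have "norm (F \<tau> y - y - \<tau> *\<^sub>R 0) = \<tau> * norm ((F \<tau> y - y) /\<^sub>R \<tau>)"
        using elim(2) by simp
      also have "real m * (K * (\<tau> * norm ((F \<tau> y - y) /\<^sub>R \<tau>)) + \<tau> * 0) \<le> real m * (K * (\<tau> * B) + \<tau> * 0)"
        using elim y K by (intro mult_left_mono add_mono) auto
      also have "\<dots> = (real m * \<tau>) * (K * B)" by simp
      also have "\<dots> \<le> d * (K * B)" using m K \<open>B > 0\<close> by (intro mult_right_mono) auto
      finally have 1: "norm ((F \<tau> ^^ m) y - y) \<le> e / 2" using \<open>d * (K * B) \<le> e / 2\<close> by simp
      have "(F \<tau> ^^ m) z - z = ((F \<tau> ^^ m) y - y) - (F \<tau> ^^ m) (y - z) + (y - z)"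
        by (simp add: linear_diff[OF lin])
      then have "norm ((F \<tau> ^^ m) z - z) \<le> norm ((F \<tau> ^^ m) y - y) + norm ((F \<tau> ^^ m) (y - z)) + norm (y - z)"
        by (smt (verit) norm_triangle_ineq norm_triangle_ineq4)
      also have "\<dots> \<le> e / 2 + K * norm (y - z) + norm (y - z)"
        by (intro add_mono 1 bnd order_refl)
      also have "\<dots> = e / 2 + (K + 1) * norm (y - z)" by (simp add: distrib_right)
      also have "\<dots> \<le> e / 2 + (K + 1) * \<eta>"
        using y K by (intro add_left_mono mult_left_mono) auto
      finally show "norm ((F \<tau> ^^ m) z - z) \<le> e" using \<eta> by simp
    qed
  qed
  with d(1) show ?thesis by blast
qed

text \<open>Consistency holds pointwise on the graph of \<open>L\<close>. A finite net of such
  points serves all of \<open>Q\<close>, and replacing (y, z) by a net point within \<eta> changes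
  every term, including the oscillation bound, by a multiple of \<eta>. The threshold for \<tau>
  depends neither on m and \<omega> nor on the point of \<open>Q\<close>.\<close>

lemma uniform_difference:
  assumes Q: "compact Q" "Q \<subseteq> closure (Map.graph L)" and S: "S \<ge> 0" and e: "e > 0"
  shows "eventually (\<lambda>\<tau>. \<forall>m \<omega> y z. (y, z) \<in> Q \<longrightarrow> real m * \<tau> \<le> S \<longrightarrow>
            (\<forall>j<m. norm ((F \<tau> ^^ j) z - z) \<le> \<omega>) \<longrightarrow>
            norm ((F \<tau> ^^ m) y - y - (real m * \<tau>) *\<^sub>R z) \<le> real m * \<tau> * \<omega> + e) (at_right 0)"
proof -
  obtain K where K: "K \<ge> 1"
    "\<And>\<tau> m x. \<tau> \<ge> 0 \<Longrightarrow> real m * \<tau> \<le> S \<Longrightarrow> norm ((F \<tau> ^^ m) x) \<le> K * norm x"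
    using stable[of S] by metis
  \<comment> \<open>The errors will add up to (2 m \<tau> + 1) (K + 1) \<eta>, where m \<tau> is at
    most S.\<close>
  define \<eta> where "\<eta> = e / (2 * (S + 1) * (K + 1))"
  have \<eta>: "\<eta> > 0" "2 * (S + 1) * (K + 1) * \<eta> = e" using e K S by (auto simp: \<eta>_def)
  have "Q \<subseteq> (\<Union>w\<in>Map.graph L. ball w \<eta>)"
    using Q(2) \<eta> by (fastforce simp: closure_approachable subset_iff)
  then obtain W where W: "W \<subseteq> Map.graph L" "finite W" "Q \<subseteq> (\<Union>w\<in>W. ball w \<eta>)"
    using compactE_image[OF Q(1), of "Map.graph L" "\<lambda>w. ball w \<eta>"] by auto
  have "eventually (\<lambda>\<tau>. dist ((F \<tau> (fst w) - fst w) /\<^sub>R \<tau>) (snd w) < \<eta>) (at_right 0)" if "w \<in> W" for w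
    using that W \<eta> by (intro tendstoD consistent) auto
  then have "eventually (\<lambda>\<tau>. \<forall>w\<in>W. dist ((F \<tau> (fst w) - fst w) /\<^sub>R \<tau>) (snd w) < \<eta>) (at_right 0)"
    using W(2) by (intro eventually_ball_finite) auto
  then show ?thesis using eventually_at_right_less
  proof eventually_elim
    case (elim \<tau>)
    show ?case
    proof (intro allI impI)
      fix m \<omega> y z
      assume yz: "(y, z) \<in> Q" and m: "real m * \<tau> \<le> S"
        and osc: "\<forall>j<m. norm ((F \<tau> ^^ j) z - z) \<le> \<omega>"
      obtain w where w: "w \<in> W" "dist w (y, z) < \<eta>" using W(3) yz by auto
      obtain u v where uv: "w = (u, v)" by (cases w)
      have uy: "norm (u - y) < \<eta>" and vz: "norm (v - z) < \<eta>"
        using dist_fst_le[of w "(y, z)"] dist_snd_le[of w "(y, z)"] w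
        by (auto simp: uv dist_norm)
      have bnd: "norm ((F \<tau> ^^ j) x) \<le> K * norm x" if "j \<le> m" for j x
        using that elim(2) m
        by (intro K order_trans[OF mult_right_mono[of "real j" "real m" \<tau>]]) auto
      have lin: "linear (F \<tau> ^^ j)" for j using elim(2) by (intro linear_F_funpow) simp
      have bnd2: "norm ((F \<tau> ^^ j) x) + norm x \<le> (K + 1) * \<eta>" if "j \<le> m" "norm x < \<eta>" for j x
      proof -
        have "norm ((F \<tau> ^^ j) x) + norm x \<le> (K + 1) * norm x"
          using bnd[OF that(1), of x] by (simp add: distrib_right)
        also have "\<dots> \<le> (K + 1) * \<eta>" using K that by (intro mult_left_mono) auto
        finally show ?thesis .
      qed
      have "norm ((F \<tau> ^^ m) u - u - (real m * \<tau>) *\<^sub>R v)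
          \<le> real m * (K * norm (F \<tau> u - u - \<tau> *\<^sub>R v) + \<tau> * (\<omega> + (K + 1) * \<eta>))"
      proof (intro norm_funpow_diff_le bnd)
        fix j assume j: "j < m"
        have "(F \<tau> ^^ j) v - v = ((F \<tau> ^^ j) z - z) + (F \<tau> ^^ j) (v - z) - (v - z)"
          by (simp add: linear_diff[OF lin])
        then have "norm ((F \<tau> ^^ j) v - v)
            \<le> norm ((F \<tau> ^^ j) z - z) + (norm ((F \<tau> ^^ j) (v - z)) + norm (v - z))"
          by (smt (verit) norm_triangle_ineq norm_triangle_ineq4)
        also have "\<dots> \<le> \<omega> + (K + 1) * \<eta>"
          using j osc vz by (intro add_mono bnd2) auto
        finally show "norm ((F \<tau> ^^ j) v - v) \<le> \<omega> + (K + 1) * \<eta>" .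
      qed (use lin[of 1] elim(2) in auto)
      also have "F \<tau> u - u - \<tau> *\<^sub>R v = \<tau> *\<^sub>R ((F \<tau> u - u) /\<^sub>R \<tau> - v)"
        using elim(2) by (simp add: scaleR_diff_right)
      also have "norm (\<tau> *\<^sub>R ((F \<tau> u - u) /\<^sub>R \<tau> - v)) = \<tau> * norm ((F \<tau> u - u) /\<^sub>R \<tau> - v)"
        using elim(2) by simp
      also have "real m * (K * (\<tau> * norm ((F \<tau> u - u) /\<^sub>R \<tau> - v)) + \<tau> * (\<omega> + (K + 1) * \<eta>))
          \<le> real m * (K * (\<tau> * \<eta>) + \<tau> * (\<omega> + (K + 1) * \<eta>))"
        using elim w K by (intro mult_left_mono add_mono) (force simp: uv dist_norm)+
      finally have 1: "norm ((F \<tau> ^^ m) u - u - (real m * \<tau>) *\<^sub>R v)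
          \<le> real m * \<tau> * \<omega> + real m * \<tau> * ((2 * K + 1) * \<eta>)"
        by (simp add: algebra_simps)
      have 2: "norm ((real m * \<tau>) *\<^sub>R (v - z)) \<le> real m * \<tau> * \<eta>"
        using elim(2) vz by (simp add: mult_left_mono)
      have "(F \<tau> ^^ m) y - y - (real m * \<tau>) *\<^sub>R z
          = ((F \<tau> ^^ m) u - u - (real m * \<tau>) *\<^sub>R v) - (F \<tau> ^^ m) (u - y) + (u - y)
            + (real m * \<tau>) *\<^sub>R (v - z)"
        by (simp add: linear_diff[OF lin] scaleR_diff_right)
      then have "norm ((F \<tau> ^^ m) y - y - (real m * \<tau>) *\<^sub>R z)
          \<le> norm ((F \<tau> ^^ m) u - u - (real m * \<tau>) *\<^sub>R v) + (norm ((F \<tau> ^^ m) (u - y)) + norm (u - y))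
            + norm ((real m * \<tau>) *\<^sub>R (v - z))"
        by (smt (verit) norm_triangle_ineq norm_triangle_ineq4)
      also have "\<dots> \<le> real m * \<tau> * \<omega> + real m * \<tau> * ((2 * K + 1) * \<eta>) + (K + 1) * \<eta> + real m * \<tau> * \<eta>"
        using uy by (intro add_mono 1 2 bnd2) auto
      also have "\<dots> = real m * \<tau> * \<omega> + (2 * (real m * \<tau>) + 1) * ((K + 1) * \<eta>)"
        by (simp add: algebra_simps)
      also have "\<dots> \<le> real m * \<tau> * \<omega> + (2 * (S + 1)) * ((K + 1) * \<eta>)"
        using m K \<eta> by (intro add_left_mono mult_right_mono) auto
      also have "\<dots> = real m * \<tau> * \<omega> + e" using \<eta>(2) by (simp add: mult.assoc)
      finally show "norm ((F \<tau> ^^ m) y - y - (real m * \<tau>) *\<^sub>R z) \<le> real m * \<tau> * \<omega> + e" .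
    qed
  qed
qed

text \<open>Telescoping over blocks of \<open>q = \<lfloor>\<delta> / \<tau>\<rfloor>\<close> factors: a block acts for a time in
  \<open>[\<delta> / 2, \<delta>]\<close>, so the number of blocks stays bounded as \<open>\<tau>\<close> tends to \<open>0\<close>.\<close>

lemma chernoff_generator_domain:
  assumes T: "c0_semigroup T" and G: "Map.graph (generator T) = closure (Map.graph L)"
    and xz: "(x, z) \<in> Map.graph (generator T)" and S: "S \<ge> 0" and e: "e > 0"
  shows "eventually (\<lambda>\<tau>. \<forall>m. real m * \<tau> \<le> S \<longrightarrow> norm ((F \<tau> ^^ m) x - T (real m * \<tau>) x) \<le> e) (at_right 0)"
proof -
  obtain K where K: "K \<ge> 1"
    "\<And>\<tau> m x. \<tau> \<ge> 0 \<Longrightarrow> real m * \<tau> \<le> S \<Longrightarrow> norm ((F \<tau> ^^ m) x) \<le> K * norm x"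
    using stable[of S] by metis
  \<comment> \<open>The oscillation errors of all blocks together, at most 2 K S \<omega>, may use
    one half of e; S + 1 avoids a division by zero.\<close>
  define \<omega> where "\<omega> = e / (4 * K * (S + 1))"
  have "4 * K * (S + 1) > 0" using K(1) S by simp
  then have \<omega>: "\<omega> > 0" "4 * K * (S + 1) * \<omega> = e" using e by (auto simp: \<omega>_def)
  define Z where "Z = (\<lambda>s. T s z) ` {0..S}"
  define Q where "Q = (\<lambda>s. (T s x, T s z)) ` {0..S}"
  have Z: "compact Z"
    unfolding Z_def by (intro compact_continuous_image c0_semigroup_continuous_on T) auto
  have Q: "compact Q"
    unfolding Q_def by (intro compact_continuous_image continuous_on_Pair c0_semigroup_continuous_on T) auto
  have QG: "Q \<subseteq> Map.graph (generator T)"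
    using generator_semigroup_invariant[OF T _ xz] by (auto simp: Q_def)
  obtain \<delta>\<^sub>1 where \<delta>\<^sub>1: "\<delta>\<^sub>1 > 0" and ev\<^sub>1: "eventually (\<lambda>\<tau>. \<forall>m. real m * \<tau> \<le> \<delta>\<^sub>1 \<longrightarrow> (\<forall>z\<in>Z. norm ((F \<tau> ^^ m) z - z) \<le> \<omega>)) (at_right 0)"
    using uniform_osc[OF Z \<omega>(1)] by blast
  obtain \<delta>\<^sub>2 where \<delta>\<^sub>2: "\<delta>\<^sub>2 > 0" "\<And>s r. s \<in> {0..\<delta>\<^sub>2} \<Longrightarrow> r \<in> {0..S} \<Longrightarrow> norm (T s (T r z) - T r z) \<le> \<omega>"
    using c0_semigroup_osc_orbit[OF T \<omega>(1)] by metis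
  define \<delta> where "\<delta> = min \<delta>\<^sub>1 \<delta>\<^sub>2"
  have \<delta>: "\<delta> > 0" using \<delta>\<^sub>1 \<delta>\<^sub>2 by (simp add: \<delta>_def)
  \<comment> \<open>Enough blocks to fill [0, S] when every full block lasts at least \<delta> /
    2.\<close>
  define P where "P = Suc (nat \<lceil>2 * S / \<delta>\<rceil>)"
  have P: "real P > 0" "S \<le> real P * (\<delta> / 2)"
  proof -
    have "2 * S / \<delta> \<le> real P" unfolding P_def using real_nat_ceiling_ge[of "2 * S / \<delta>"] by simp
    then show "S \<le> real P * (\<delta> / 2)" using \<delta> by (simp add: field_simps)
  qed (simp add: P_def)
  \<comment> \<open>The additive errors of P blocks, each multiplied by \<open>K\<close>, may use
    the other half of e.\<close>
  define e' where "e' = e / (2 * K * real P)"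
  have e': "e' > 0" using e K P by (simp add: e'_def)
  have ev\<^sub>2: "eventually (\<lambda>\<tau>. \<forall>m \<omega> y z. (y, z) \<in> Q \<longrightarrow> real m * \<tau> \<le> S \<longrightarrow>
            (\<forall>j<m. norm ((F \<tau> ^^ j) z - z) \<le> \<omega>) \<longrightarrow>
            norm ((F \<tau> ^^ m) y - y - (real m * \<tau>) *\<^sub>R z) \<le> real m * \<tau> * \<omega> + e') (at_right 0)"
    using QG G by (intro uniform_difference Q S e') simp
  have ev\<^sub>3: "eventually (\<lambda>\<tau>. \<tau> \<in> {0<..<\<delta>/2}) (at_right 0)"
    using \<delta> by (intro eventually_at_right_real) simp
  from ev\<^sub>1 ev\<^sub>2 ev\<^sub>3 show ?thesis
  proof eventually_elim
    case (elim \<tau>)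
    have \<tau>: "\<tau> > 0" "\<tau> < \<delta> / 2" using elim(3) by auto
    have lin: "linear (F \<tau> ^^ j)" for j using \<tau> by (intro linear_F_funpow) simp
    define q where "q = nat \<lfloor>\<delta> / \<tau>\<rfloor>"
    have "real q \<le> \<delta> / \<tau>" "\<delta> / \<tau> < real q + 1"
      using \<delta> \<tau> by (auto simp: q_def)
    \<comment> \<open>Rounding down loses less than one step, and a step is shorter than \<delta> /
      2.\<close>
    then have q: "real q * \<tau> \<le> \<delta>" "\<delta> / 2 \<le> real q * \<tau>"
      using \<tau> by (auto simp: field_simps)
    have block: "norm ((F \<tau> ^^ b) (T s x) - T (real b * \<tau> + s) x) \<le> 2 * (real b * \<tau>) * \<omega> + e'"
      if b: "b \<le> q" and s: "s \<ge> 0" "s + real b * \<tau> \<le> S" for b s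
    proof -
      have b\<tau>: "real b * \<tau> \<ge> 0" "real b * \<tau> \<le> \<delta>"
        using \<tau> b order_trans[OF mult_right_mono[of "real b" "real q" \<tau>] q(1)] by auto
      have sS: "s \<in> {0..S}" using s b\<tau> by auto
      have "norm ((F \<tau> ^^ b) (T s x) - T s x - (real b * \<tau>) *\<^sub>R T s z) \<le> real b * \<tau> * \<omega> + e'"
      proof (rule elim(2)[rule_format])
        show "(T s x, T s z) \<in> Q" using sS by (auto simp: Q_def)
        show "real b * \<tau> \<le> S" using s by simp
        fix j assume "j < b"
        then have "real j * \<tau> \<le> \<delta>\<^sub>1"
          using \<tau> b\<tau> by (intro order_trans[OF mult_right_mono[of "real j" "real b" \<tau>]]) (auto simp: \<delta>_def)
        then show "norm ((F \<tau> ^^ j) (T s z) - T s z) \<le> \<omega>"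
          using elim(1) sS by (auto simp: Z_def)
      qed
      moreover have "norm (T (real b * \<tau>) (T s x) - T s x - (real b * \<tau>) *\<^sub>R T s z) \<le> real b * \<tau> * \<omega>"
        using b\<tau> sS s by (intro generator_difference_le[OF T] generator_semigroup_invariant[OF T _ xz] \<delta>\<^sub>2) (auto simp: \<delta>_def)
      moreover have "T (real b * \<tau>) (T s x) = T (real b * \<tau> + s) x"
        using b\<tau> s c0_semigroup_add[OF T] by simp
      moreover have "(F \<tau> ^^ b) (T s x) - T (real b * \<tau> + s) x
          = ((F \<tau> ^^ b) (T s x) - T s x - (real b * \<tau>) *\<^sub>R T s z)
            - (T (real b * \<tau> + s) x - T s x - (real b * \<tau>) *\<^sub>R T s z)" by simp
      ultimately show ?thesis
        using norm_triangle_ineq4[of "(F \<tau> ^^ b) (T s x) - T s x - (real b * \<tau>) *\<^sub>R T s z"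
            "T (real b * \<tau> + s) x - T s x - (real b * \<tau>) *\<^sub>R T s z"] by simp
    qed
    \<comment> \<open>The induction peels off the block that acts first, so the starting time s must
      vary. The remaining factors act on the block error as one power, so \<open>K\<close>
      multiplies each block error only once and no power of \<open>K\<close> builds up.\<close>
    have telescope: "norm ((F \<tau> ^^ m) (T s x) - T (real m * \<tau> + s) x) \<le> K * (2 * (real m * \<tau>) * \<omega> + real p * e')"
      if "m \<le> p * q" "s \<ge> 0" "s + real m * \<tau> \<le> S" for m p s
      using that
    proof (induction p arbitrary: m s)
      case 0
      then show ?case by simp
    next
      case (Suc p)
      define b where "b = min m q"
      define m' where "m' = m - b"
      have m: "m = m' + b" "real m * \<tau> = real m' * \<tau> + real b * \<tau>" "b \<le> q" "m' \<le> p * q"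
        using Suc.prems(1) by (auto simp: m'_def b_def of_nat_diff algebra_simps)
      have nonneg: "real m' * \<tau> \<ge> 0" "real b * \<tau> \<ge> 0" using \<tau> by auto
      have m'S: "real m' * \<tau> \<le> S" using nonneg m(2) Suc.prems by linarith
      have "(F \<tau> ^^ m) (T s x) - T (real m * \<tau> + s) x
          = (F \<tau> ^^ m') ((F \<tau> ^^ b) (T s x) - T (real b * \<tau> + s) x)
            + ((F \<tau> ^^ m') (T (real b * \<tau> + s) x) - T (real m' * \<tau> + (real b * \<tau> + s)) x)"
        unfolding m(2) by (simp add: m(1) funpow_add linear_diff[OF lin] add.assoc)
      also have "norm \<dots> \<le> norm ((F \<tau> ^^ m') ((F \<tau> ^^ b) (T s x) - T (real b * \<tau> + s) x))
            + norm ((F \<tau> ^^ m') (T (real b * \<tau> + s) x) - T (real m' * \<tau> + (real b * \<tau> + s)) x)"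
        by (rule norm_triangle_ineq)
      also have "\<dots> \<le> K * (2 * (real b * \<tau>) * \<omega> + e') + K * (2 * (real m' * \<tau>) * \<omega> + real p * e')"
      proof (rule add_mono)
        show "norm ((F \<tau> ^^ m') (T (real b * \<tau> + s) x) - T (real m' * \<tau> + (real b * \<tau> + s)) x)
            \<le> K * (2 * (real m' * \<tau>) * \<omega> + real p * e')"
          using m nonneg Suc.prems by (intro Suc.IH) auto
        have "norm ((F \<tau> ^^ m') ((F \<tau> ^^ b) (T s x) - T (real b * \<tau> + s) x))
            \<le> K * norm ((F \<tau> ^^ b) (T s x) - T (real b * \<tau> + s) x)"
          using \<tau> m'S by (intro K) auto
        also have "\<dots> \<le> K * (2 * (real b * \<tau>) * \<omega> + e')"
          using K m nonneg Suc.prems by (intro mult_left_mono block) auto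
        finally show "norm ((F \<tau> ^^ m') ((F \<tau> ^^ b) (T s x) - T (real b * \<tau> + s) x))
            \<le> K * (2 * (real b * \<tau>) * \<omega> + e')" .
      qed
      also have "\<dots> = K * (2 * (real m * \<tau>) * \<omega> + real (Suc p) * e')"
        unfolding m(2) by (simp add: algebra_simps)
      finally show ?case .
    qed
    show ?case
    proof (intro allI impI)
      fix m assume m: "real m * \<tau> \<le> S"
      have "real m * \<tau> \<le> real P * (real q * \<tau>)"
        using m P q by (smt (verit) mult_left_mono)
      then have "real m \<le> real (P * q)" using \<tau> by simp
      then have "m \<le> P * q" by (simp only: of_nat_le_iff)
      then have "norm ((F \<tau> ^^ m) (T 0 x) - T (real m * \<tau> + 0) x) \<le> K * (2 * (real m * \<tau>) * \<omega> + real P * e')"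
        using m by (intro telescope) auto
      also have "\<dots> \<le> K * (2 * (S + 1) * \<omega> + real P * e')"
        using m K \<omega> by (intro mult_left_mono add_right_mono mult_right_mono) auto
      also have "\<dots> = K * (2 * (S + 1) * \<omega>) + K * (real P * e')" by (rule distrib_left)
      also have "K * (2 * (S + 1) * \<omega>) = e / 2"
        using \<omega>(2) by (simp add: algebra_simps)
      also have "K * (real P * e') = e / 2"
        using K(1) P by (simp add: e'_def)
      finally show "norm ((F \<tau> ^^ m) x - T (real m * \<tau>) x) \<le> e"
        by (simp add: c0_semigroup_zero[OF T])
    qed
  qed
qed

text \<open>Both families are bounded on [0, S], and for \<open>F\<close> uniformly in \<tau>, so
  the approximation extends from the dense domain of \<open>L\<close> to every x.\<close>

theorem chernoff:
  assumes T: "c0_semigroup T" and G: "Map.graph (generator T) = closure (Map.graph L)"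
    and S: "S \<ge> 0" and e: "e > 0"
  shows "eventually (\<lambda>\<tau>. \<forall>m. real m * \<tau> \<le> S \<longrightarrow> norm ((F \<tau> ^^ m) x - T (real m * \<tau>) x) \<le> e) (at_right 0)"
proof -
  obtain K\<^sub>1 where K\<^sub>1: "K\<^sub>1 \<ge> 1"
    "\<And>\<tau> m x. \<tau> \<ge> 0 \<Longrightarrow> real m * \<tau> \<le> S \<Longrightarrow> norm ((F \<tau> ^^ m) x) \<le> K\<^sub>1 * norm x"
    using stable[of S] by metis
  obtain K\<^sub>2 where K\<^sub>2: "K\<^sub>2 \<ge> 1" "\<And>s x. s \<in> {0..S} \<Longrightarrow> norm (T s x) \<le> K\<^sub>2 * norm x"
    using c0_semigroup_bounded[OF T] by metis
  define \<eta> where "\<eta> = e / (2 * (K\<^sub>1 + K\<^sub>2))"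
  have \<eta>: "\<eta> > 0" "(K\<^sub>1 + K\<^sub>2) * \<eta> = e / 2" using e K\<^sub>1(1) K\<^sub>2(1) by (auto simp: \<eta>_def field_split_simps)
  have "x \<in> closure (dom L)" using dense_dom by simp
  then obtain y z where y: "L y = Some z" "dist y x < \<eta>"
    using \<eta>(1) unfolding closure_approachable by blast
  then have "(y, z) \<in> Map.graph (generator T)"
    unfolding G by (intro subsetD[OF closure_subset]) (simp add: Map.graph_def)
  from chernoff_generator_domain[OF T G this S, of "e / 2"] e
  have "eventually (\<lambda>\<tau>. \<forall>m. real m * \<tau> \<le> S \<longrightarrow> norm ((F \<tau> ^^ m) y - T (real m * \<tau>) y) \<le> e / 2) (at_right 0)"
    by simp
  then show ?thesis using eventually_at_right_less
  proof eventually_elim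
    case (elim \<tau>)
    show ?case
    proof (intro allI impI)
      fix m assume m: "real m * \<tau> \<le> S"
      have s: "real m * \<tau> \<in> {0..S}" using m elim(2) by simp
      have "(F \<tau> ^^ m) x - T (real m * \<tau>) x
          = ((F \<tau> ^^ m) y - T (real m * \<tau>) y) - (F \<tau> ^^ m) (y - x) + T (real m * \<tau>) (y - x)"
        using s elim(2) by (simp add: linear_diff[OF linear_F_funpow] linear_simps[OF c0_semigroup_linear[OF T]])
      then have "norm ((F \<tau> ^^ m) x - T (real m * \<tau>) x)
          \<le> norm ((F \<tau> ^^ m) y - T (real m * \<tau>) y) + norm ((F \<tau> ^^ m) (y - x)) + norm (T (real m * \<tau>) (y - x))"
        by (smt (verit) norm_triangle_ineq norm_triangle_ineq4)
      also have "\<dots> \<le> e / 2 + K\<^sub>1 * norm (y - x) + K\<^sub>2 * norm (y - x)"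
        using elim m s by (intro add_mono K\<^sub>1 K\<^sub>2) auto
      also have "\<dots> = e / 2 + (K\<^sub>1 + K\<^sub>2) * norm (y - x)" by (simp add: distrib_right)
      also have "\<dots> \<le> e / 2 + (K\<^sub>1 + K\<^sub>2) * \<eta>"
        using y(2) K\<^sub>1(1) K\<^sub>2(1) by (intro add_left_mono mult_left_mono) (auto simp: dist_norm)
      finally show "norm ((F \<tau> ^^ m) x - T (real m * \<tau>) x) \<le> e" using \<eta> by simp
    qed
  qed
qed

text \<open>Asking only that the total times \<open>k n * \<tau> n\<close> converge covers both
  [n s] factors of step t / n and n factors of step s / n.\<close>

corollary chernoff_tendsto:
  assumes T: "c0_semigroup T" and G: "Map.graph (generator T) = closure (Map.graph L)"
    and \<tau>: "filterlim \<tau> (at_right 0) sequentially"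
    and k: "(\<lambda>n. real (k n) * \<tau> n) \<longlonglongrightarrow> s"
  shows "(\<lambda>n. (F (\<tau> n) ^^ k n) x) \<longlonglongrightarrow> T s x"
proof -
  have \<tau>pos: "eventually (\<lambda>n. \<tau> n > 0) sequentially"
    using eventually_compose_filterlim[OF eventually_at_right_less \<tau>] .
  have k0: "eventually (\<lambda>n. real (k n) * \<tau> n \<ge> 0) sequentially"
    using \<tau>pos by eventually_elim simp
  then have s: "s \<ge> 0" by (intro tendsto_lowerbound[OF k]) auto
  \<comment> \<open>The total times may approach s from above, so the approximation is applied on
    [0, s + 1].\<close>
  have kS: "eventually (\<lambda>n. real (k n) * \<tau> n < s + 1) sequentially"
    by (rule order_tendstoD(2)[OF k]) simp
  have "(\<lambda>n. T (real (k n) * \<tau> n) x) \<longlonglongrightarrow> T s x"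
    using s k0 kS
    by (intro continuous_on_tendsto_compose[OF c0_semigroup_continuous_on[OF T, of "s + 1"] k])
       (auto elim: eventually_elim2)
  moreover have "(\<lambda>n. (F (\<tau> n) ^^ k n) x - T (real (k n) * \<tau> n) x) \<longlonglongrightarrow> 0"
  proof (rule tendstoI)
    fix e :: real assume e: "e > 0"
    from eventually_compose_filterlim[OF chernoff[OF T G, of "s + 1" "e / 2" x] \<tau>] e s
    have "eventually (\<lambda>n. \<forall>m. real m * \<tau> n \<le> s + 1 \<longrightarrow> norm ((F (\<tau> n) ^^ m) x - T (real m * \<tau> n) x) \<le> e / 2) sequentially"
      by simp
    with kS show "eventually (\<lambda>n. dist ((F (\<tau> n) ^^ k n) x - T (real (k n) * \<tau> n) x) 0 < e) sequentially"
    proof eventually_elim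
      case (elim n)
      then have "norm ((F (\<tau> n) ^^ k n) x - T (real (k n) * \<tau> n) x) \<le> e / 2" by simp
      with e show ?case by simp
    qed
  qed
  ultimately show ?thesis using tendsto_add by fastforce
qed

end

section \<open>Limits along filters\<close>

lemma subspace_closure:
  fixes S :: "'a::real_normed_vector set"
  assumes S: "subspace S"
  shows "subspace (closure S)"
proof (rule subspaceI)
  show "0 \<in> closure S" using subspace_0[OF S] closure_subset by blast
  show "x + y \<in> closure S" if "x \<in> closure S" "y \<in> closure S" for x y
  proof -
    obtain u v where "\<And>n. u n \<in> S" "u \<longlonglongrightarrow> x" "\<And>n. v n \<in> S" "v \<longlonglongrightarrow> y"
      using \<open>x \<in> closure S\<close> \<open>y \<in> closure S\<close> unfolding closure_sequential by metis
    then show ?thesis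
      unfolding closure_sequential
      by (intro exI[of _ "\<lambda>n. u n + v n"] conjI allI tendsto_add subspace_add[OF S])
  qed
  show "c *\<^sub>R x \<in> closure S" if "x \<in> closure S" for c x
  proof -
    obtain u where "\<And>n. u n \<in> S" "u \<longlonglongrightarrow> x"
      using \<open>x \<in> closure S\<close> unfolding closure_sequential by metis
    then show ?thesis
      unfolding closure_sequential
      by (intro exI[of _ "\<lambda>n. c *\<^sub>R u n"] conjI allI tendsto_scaleR tendsto_const subspace_scale[OF S])
  qed
qed

text \<open>The filter analogue of a convergent subsequence: refine \<open>F\<close> by the
  preimages of the neighbourhoods of a cluster point z. Were the result trivial, u would eventually
  avoid some neighbourhood of z.\<close>

lemma compact_convergent_subfilter:
  assumes K: "compact K" and F: "F \<noteq> bot" and u: "eventually (\<lambda>n. u n \<in> K) F"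
  shows "\<exists>G z. z \<in> K \<and> G \<noteq> bot \<and> G \<le> F \<and> (u \<longlongrightarrow> z) G"
proof -
  obtain z where z: "z \<in> K" "inf (nhds z) (filtermap u F) \<noteq> bot"
    using K[unfolded compact_filter, rule_format, of "filtermap u F"] F u
    by (auto simp: filtermap_bot_iff eventually_filtermap)
  define G where "G = inf F (filtercomap u (nhds z))"
  have "G \<noteq> bot"
  proof
    assume "G = bot"
    then obtain P Q where PQ: "eventually P F" "eventually Q (nhds z)" "\<And>n. P n \<Longrightarrow> Q (u n) \<Longrightarrow> False"
      unfolding G_def trivial_limit_def eventually_inf eventually_filtercomap by metis
    have "eventually (\<lambda>x. \<not> Q x) (filtermap u F)"
      using PQ(1) unfolding eventually_filtermap by eventually_elim (use PQ(3) in blast)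
    with PQ(2) have "eventually (\<lambda>x. False) (inf (nhds z) (filtermap u F))"
      unfolding eventually_inf by blast
    with z(2) show False by (simp add: trivial_limit_def)
  qed
  moreover have "(u \<longlongrightarrow> z) G"
    unfolding G_def by (rule filterlim_mono[OF filterlim_filtercomap]) auto
  moreover have "G \<le> F" by (simp add: G_def)
  ultimately show ?thesis using z(1) by blast
qed

text \<open>Tychonoff's theorem makes all the sequences \<open>\<lambda>n. v n i\<close> converge along one filter, where
  a diagonal subsequence would only handle countably many indices.\<close>

lemma simultaneous_convergent_subfilter:
  fixes v :: "'n \<Rightarrow> 'i \<Rightarrow> 'a::topological_space"
  assumes K: "\<And>i. compact (K i)" and F: "F \<noteq> bot" and v: "eventually (\<lambda>n. \<forall>i. v n i \<in> K i) F"
  shows "\<exists>G w. G \<noteq> bot \<and> G \<le> F \<and> (\<forall>i. ((\<lambda>n. v n i) \<longlongrightarrow> w i) G)"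
proof -
  have "compactin (product_topology (\<lambda>i. euclidean) UNIV) (PiE UNIV K)"
    using K by (simp add: compactin_PiE)
  then have "compact (PiE UNIV K)" by (simp add: euclidean_product_topology)
  from compact_convergent_subfilter[OF this F, of v] v
  obtain G w where G: "G \<noteq> bot" "G \<le> F" "(v \<longlongrightarrow> w) G" by (auto simp: PiE_iff)
  have "((\<lambda>n. v n i) \<longlongrightarrow> w i) G" for i
    by (rule continuous_on_tendsto_compose[OF continuous_on_product_coordinates G(3)]) auto
  with G show ?thesis by blast
qed

section \<open>Semigroups from precompact orbits\<close>

text \<open>\<open>real n * (s / t)\<close> is the time s measured in steps t / n, and the floor
  counts the whole steps. From here on s is the elapsed time, that is, t times the parameter s of
  conditions (a) and (b).\<close>

lemma power_at_time:
  assumes "t > 0" and "n \<ge> 1" and "s \<ge> 0"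
  shows "real (nat \<lfloor>real n * (s / t)\<rfloor>) * (t / real n) \<le> s"
    and "s - t / real n < real (nat \<lfloor>real n * (s / t)\<rfloor>) * (t / real n)"
proof -
  define \<tau> k where "\<tau> = t / real n" and "k = nat \<lfloor>real n * (s / t)\<rfloor>"
  have \<tau>: "\<tau> > 0" "real n * (s / t) = s / \<tau>" using assms by (simp_all add: \<tau>_def)
  moreover have "s / \<tau> \<ge> 0" using assms \<tau>(1) by simp
  ultimately have "real k \<le> s / \<tau>" "s / \<tau> < real k + 1" unfolding k_def by linarith+
  then have "real k * \<tau> \<le> s" "s - \<tau> < real k * \<tau>"
    using \<tau>(1) by (simp_all add: field_simps)
  then show "real (nat \<lfloor>real n * (s / t)\<rfloor>) * (t / real n) \<le> s"
    and "s - t / real n < real (nat \<lfloor>real n * (s / t)\<rfloor>) * (t / real n)"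
    unfolding \<tau>_def k_def .
qed

text \<open>Discrete times fail to be additive by at most one step; this is the defect to be
  controlled in the semigroup law.\<close>

lemma nat_floor_add:
  assumes "\<alpha> \<ge> 0" "\<beta> \<ge> (0::real)"
  shows "nat \<lfloor>\<alpha> + \<beta>\<rfloor> = nat \<lfloor>\<alpha>\<rfloor> + nat \<lfloor>\<beta>\<rfloor> \<or> nat \<lfloor>\<alpha> + \<beta>\<rfloor> = Suc (nat \<lfloor>\<alpha>\<rfloor> + nat \<lfloor>\<beta>\<rfloor>)"
proof -
  have "\<lfloor>\<alpha> + \<beta>\<rfloor> = \<lfloor>\<alpha>\<rfloor> + \<lfloor>\<beta>\<rfloor> \<or> \<lfloor>\<alpha> + \<beta>\<rfloor> = 1 + (\<lfloor>\<alpha>\<rfloor> + \<lfloor>\<beta>\<rfloor>)" by (simp add: floor_add)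
  moreover have "\<lfloor>\<alpha>\<rfloor> \<ge> 0" "\<lfloor>\<beta>\<rfloor> \<ge> 0" using assms by simp_all
  ultimately show ?thesis by linarith
qed

lemma filterlim_step: "t > 0 \<Longrightarrow> filterlim (\<lambda>n. t / real n) (at_right 0) sequentially"
  using lim_const_over_n[of t] unfolding filterlim_at
  by (auto intro!: eventually_sequentiallyI[of 1])

lemma tendsto_time:
  assumes "t > 0" and "s \<ge> 0"
  shows "(\<lambda>n. real (nat \<lfloor>real n * (s / t)\<rfloor>) * (t / real n)) \<longlonglongrightarrow> s"
proof (rule real_tendsto_sandwich)
  show "(\<lambda>n. s - t / real n) \<longlonglongrightarrow> s"
    using tendsto_diff[OF tendsto_const lim_const_over_n, of s t] by simp
  show "eventually (\<lambda>n. s - t / real n \<le> real (nat \<lfloor>real n * (s / t)\<rfloor>) * (t / real n)) sequentially"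
    using power_at_time(2)[OF assms(1) _ assms(2)]
    by (intro eventually_sequentiallyI[of 1] less_imp_le)
  show "eventually (\<lambda>n. real (nat \<lfloor>real n * (s / t)\<rfloor>) * (t / real n) \<le> s) sequentially"
    using power_at_time(1)[OF assms(1) _ assms(2)] by (intro eventually_sequentiallyI[of 1])
qed simp

context chernoff_family
begin

text \<open>Total boundedness: by stability x may be replaced by a nearby f in \<open>A\<close>
  uniformly in n, and by (a) the orbit of f stays close to the precompact sequence g for all but
  finitely many n.\<close>

lemma compact_closure_orbit:
  assumes t: "t > 0" and s: "s \<ge> 0" and A: "closure A = UNIV"
    and approx: "\<And>f. f \<in> A \<Longrightarrow> \<exists>g :: nat \<Rightarrow> 'a.
      (\<lambda>n. norm ((F (t / real n) ^^ nat \<lfloor>real n * (s / t)\<rfloor>) f - g n)) \<longlonglongrightarrow> 0 \<and> compact (closure (g ` {1..}))"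
  shows "compact (closure ((\<lambda>n. (F (t / real n) ^^ nat \<lfloor>real n * (s / t)\<rfloor>) x) ` {1..}))"
proof -
  define V where "V n = F (t / real n) ^^ nat \<lfloor>real n * (s / t)\<rfloor>" for n
  obtain K where K: "K \<ge> 1"
    "\<And>\<tau> m x. \<tau> \<ge> 0 \<Longrightarrow> real m * \<tau> \<le> s \<Longrightarrow> norm ((F \<tau> ^^ m) x) \<le> K * norm x"
    using stable[of s] by metis
  have linV: "linear (V n)" for n
    unfolding V_def using t by (intro linear_F_funpow) simp
  have V: "norm (V n y) \<le> K * norm y" if "n \<ge> 1" for n y
    unfolding V_def using t power_at_time(1)[OF t that s] by (intro K) auto
  have "\<exists>k. finite k \<and> closure ((\<lambda>n. V n x) ` {1..}) \<subseteq> (\<Union>p\<in>k. ball p e)" if e: "e > 0" for e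
  proof -
    have "x \<in> closure A" using A by simp
    then obtain f where f: "f \<in> A" "dist f x < e / (4 * K)"
      using e K(1) unfolding closure_approachable by (metis divide_pos_pos mult_pos_pos zero_less_numeral less_le_trans zero_less_one)
    obtain g :: "nat \<Rightarrow> 'a" where g: "(\<lambda>n. norm (V n f - g n)) \<longlonglongrightarrow> 0" "compact (closure (g ` {1..}))"
      using approx[OF f(1)] unfolding V_def by blast
    have "\<exists>k. finite k \<and> closure (g ` {1..}) \<subseteq> (\<Union>p\<in>k. ball p (e / 4))"
      using g(2) e unfolding compact_eq_totally_bounded by simp
    then obtain k where k: "finite k" "closure (g ` {1..}) \<subseteq> (\<Union>p\<in>k. ball p (e / 4))" by blast
    have "eventually (\<lambda>n. norm (V n f - g n) < e / 4) sequentially"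
      using g(1) e by (intro order_tendstoD(2)[OF g(1)]) simp
    then obtain N where N: "\<And>n. n \<ge> N \<Longrightarrow> norm (V n f - g n) < e / 4"
      unfolding eventually_sequentially by blast
    \<comment> \<open>The finitely many terms before \<open>N\<close>, not yet close to those of g,
      serve as their own centres.\<close>
    define k' where "k' = k \<union> (\<lambda>n. V n x) ` {..<N}"
    have fin: "finite k'" using k(1) by (simp add: k'_def)
    \<comment> \<open>The radius collects three errors of e / 4. A finite union of closed balls is
      closed, so it also contains the closure.\<close>
    have "(\<lambda>n. V n x) ` {1..} \<subseteq> (\<Union>p\<in>k'. cball p (3 * e / 4))"
    proof (rule image_subsetI)
      fix n :: nat assume n: "n \<in> {1..}"
      show "V n x \<in> (\<Union>p\<in>k'. cball p (3 * e / 4))"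
      proof (cases "n < N")
        case True
        then have "V n x \<in> k'" by (auto simp: k'_def)
        moreover have "V n x \<in> cball (V n x) (3 * e / 4)" using e by simp
        ultimately show ?thesis by blast
      next
        case False
        have "g n \<in> closure (g ` {1..})" using n by (intro subsetD[OF closure_subset]) blast
        then obtain p where p: "p \<in> k" "dist p (g n) < e / 4" using k(2) by auto
        have "norm (V n (x - f)) \<le> K * norm (x - f)" using n by (intro V) simp
        also have "\<dots> \<le> K * (e / (4 * K))"
          using f(2) K(1) by (intro mult_left_mono) (auto simp: dist_norm norm_minus_commute)
        finally have 1: "norm (V n (x - f)) \<le> e / 4" using K(1) by simp
        have "p - V n x = (p - g n) - V n (x - f) - (V n f - g n)"
          by (simp add: linear_diff[OF linV])
        then have "norm (p - V n x) \<le> norm (p - g n) + norm (V n (x - f)) + norm (V n f - g n)"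
          by (smt (verit) norm_triangle_ineq4)
        also have "\<dots> \<le> 3 * e / 4" using p(2) 1 N[of n] False by (simp add: dist_norm)
        finally have "V n x \<in> cball p (3 * e / 4)" by (simp add: dist_norm)
        moreover have "p \<in> k'" using p(1) by (simp add: k'_def)
        ultimately show ?thesis by blast
      qed
    qed
    then have "closure ((\<lambda>n. V n x) ` {1..}) \<subseteq> (\<Union>p\<in>k'. cball p (3 * e / 4))"
      using fin by (intro closure_minimal) auto
    also have "\<dots> \<subseteq> (\<Union>p\<in>k'. ball p e)" using e by (intro UN_mono) auto
    finally show ?thesis using fin by blast
  qed
  then have "compact (closure ((\<lambda>n. V n x) ` {1..}))"
    unfolding compact_eq_totally_bounded by (auto simp: complete_eq_closed)
  then show ?thesis by (simp add: V_def)
qed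

text \<open>The two inclusions have different sources: consistency puts the closure of
  \<open>L\<close> inside the generator, while the precompact images in (b) give the reverse
  inclusion through the core criterion \<open>generator_subset_closed_subspace\<close>.\<close>

theorem semigroup_of_precompact_orbits:
  assumes t: "t > 0" and L: "linear_op L" and A: "closure A = UNIV"
    and approx: "\<And>f s. f \<in> A \<Longrightarrow> s \<ge> 0 \<Longrightarrow> \<exists>g :: nat \<Rightarrow> 'a.
      (\<forall>n\<ge>1. g n \<in> dom L) \<and>
      (\<lambda>n. norm ((F (t / real n) ^^ nat \<lfloor>real n * s\<rfloor>) f - g n)) \<longlonglongrightarrow> 0 \<and>
      precompact (g ` {1..}) \<and> precompact ((\<lambda>n. the (L (g n))) ` {1..})"
  shows "\<exists>T. c0_semigroup T \<and> Map.graph (generator T) = closure (Map.graph L)"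
proof -
  define \<kappa> where "\<kappa> n s = nat \<lfloor>real n * (s / t)\<rfloor>" for n s
  define V where "V n s = F (t / real n) ^^ \<kappa> n s" for n s
  have \<kappa>: "real (\<kappa> n s) * (t / real n) \<le> s" if "n \<ge> 1" "s \<ge> 0" for n s
    unfolding \<kappa>_def by (rule power_at_time(1)[OF t that])
  have linV: "linear (V n s)" for n s
    unfolding V_def using t by (intro linear_F_funpow) simp
  have Vbound: "\<exists>K\<ge>1. \<forall>n\<ge>1. \<forall>s\<in>{0..S}. \<forall>x. norm (V n s x) \<le> K * norm x" for S
  proof -
    obtain K where K: "K \<ge> 1"
      "\<And>\<tau> m x. \<tau> \<ge> 0 \<Longrightarrow> real m * \<tau> \<le> S \<Longrightarrow> norm ((F \<tau> ^^ m) x) \<le> K * norm x"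
      using stable[of S] by metis
    have "norm (V n s x) \<le> K * norm x" if "n \<ge> 1" "s \<in> {0..S}" for n s x
      unfolding V_def using t \<kappa>[of n s] that by (intro K) auto
    with K(1) show ?thesis by blast
  qed
  \<comment> \<open>An index is a pair of a time and a vector. Clamping the time at 0 gives a
    compact set for every index, as the simultaneous limit demands, without changing times s >=
    0.\<close>
  define K where "K i = closure ((\<lambda>n. V n (max (fst i) 0) (snd i)) ` {1..})" for i
  have compact_K: "compact (K i)" for i
    unfolding K_def V_def \<kappa>_def
    using t A approx[of _ "max (fst i) 0 / t"]
    by (intro compact_closure_orbit) (fastforce simp: precompact_def)+
  have "eventually (\<lambda>n. \<forall>i. V n (max (fst i) 0) (snd i) \<in> K i) sequentially"
    unfolding K_def
    by (intro eventually_sequentiallyI[of 1] allI subsetD[OF closure_subset] imageI) simp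
  from simultaneous_convergent_subfilter[OF compact_K _ this]
  obtain \<F> w where \<F>: "\<F> \<noteq> bot" "\<F> \<le> sequentially"
    and w: "\<And>i. ((\<lambda>n. V n (max (fst i) 0) (snd i)) \<longlongrightarrow> w i) \<F>"
    using sequentially_bot by blast
  define T where "T s x = w (s, x)" for s x
  have T: "((\<lambda>n. V n s x) \<longlongrightarrow> T s x) \<F>" if "s \<ge> 0" for s x
    using w[of "(s, x)"] that by (simp add: T_def max_absorb1)
  have ev1: "eventually (\<lambda>n. n \<ge> 1) \<F>"
    using eventually_ge_at_top[of 1] \<F>(2) by (rule filter_leD[rotated])
  have step: "filterlim (\<lambda>n. t / real n) (at_right 0) \<F>"
    using filterlim_mono[OF filterlim_step[OF t] order_refl \<F>(2)] .
  have time: "((\<lambda>n. real (\<kappa> n s) * (t / real n)) \<longlongrightarrow> s) \<F>" if "s \<ge> 0" for s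
    unfolding \<kappa>_def using filterlim_mono[OF tendsto_time[OF t that] order_refl \<F>(2)] .
  have Tbound: "\<exists>K\<ge>1. \<forall>s\<in>{0..S}. \<forall>x. norm (T s x) \<le> K * norm x" for S
  proof -
    obtain K where K: "K \<ge> 1" "\<And>n s x. n \<ge> 1 \<Longrightarrow> s \<in> {0..S} \<Longrightarrow> norm (V n s x) \<le> K * norm x"
      using Vbound[of S] by metis
    have "norm (T s x) \<le> K * norm x" if "s \<in> {0..S}" for s x
      using that K(2)
      by (intro tendsto_upperbound[OF tendsto_norm[OF T] _ \<F>(1)] eventually_mono[OF ev1]) auto
    with K(1) show ?thesis by blast
  qed
  have linT: "bounded_linear (T s)" if s: "s \<ge> 0" for s
  proof -
    obtain K where K: "\<And>r x. r \<in> {0..s} \<Longrightarrow> norm (T r x) \<le> K * norm x"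
      using Tbound[of s] by blast
    show ?thesis
    proof (rule bounded_linear_intro)
      show "norm (T s x) \<le> norm x * K" for x using K[of s x] s by (simp add: mult.commute)
      show "T s (x + y) = T s x + T s y" for x y
        using tendsto_add[OF T[OF s, of x] T[OF s, of y]] T[OF s, of "x + y"]
        by (intro tendsto_unique[OF \<F>(1)]) (auto simp: linear_add[OF linV])
      show "T s (c *\<^sub>R x) = c *\<^sub>R T s x" for c x
        using tendsto_scaleR[OF tendsto_const[of c] T[OF s, of x]] T[OF s, of "c *\<^sub>R x"]
        by (intro tendsto_unique[OF \<F>(1)]) (auto simp: linear_scale[OF linV])
    qed
  qed
  have T0: "T 0 = id"
  proof
    fix x
    have "((\<lambda>n. V n 0 x) \<longlongrightarrow> x) \<F>" by (simp add: V_def \<kappa>_def)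
    then show "T 0 x = id x" using tendsto_unique[OF \<F>(1) T[of 0 x]] by simp
  qed
  have Tadd: "T (r + s) x = T r (T s x)" if rs: "r \<ge> 0" "s \<ge> 0" for r s x
  proof -
    obtain K where K: "K \<ge> 1"
      "\<And>\<tau> m x. \<tau> \<ge> 0 \<Longrightarrow> real m * \<tau> \<le> r + s \<Longrightarrow> norm ((F \<tau> ^^ m) x) \<le> K * norm x"
      using stable[of "r + s"] by metis
    \<comment> \<open>The two sides of the semigroup law differ by at most one factor, whose effect
      on x vanishes by \<open>uniform_osc\<close> with m = 1.\<close>
    have Fx: "((\<lambda>n. K * norm (F (t / real n) x - x)) \<longlongrightarrow> 0) \<F>"
    proof -
      have "((\<lambda>\<tau>. F \<tau> x) \<longlongrightarrow> x) (at_right 0)"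
      proof (rule tendstoI)
        fix e :: real assume e: "e > 0"
        obtain d where d: "d > 0"
          and ev: "eventually (\<lambda>\<tau>. \<forall>m. real m * \<tau> \<le> d \<longrightarrow> (\<forall>z\<in>{x}. norm ((F \<tau> ^^ m) z - z) \<le> e / 2)) (at_right 0)"
          using uniform_osc[of "{x}" "e / 2"] e by auto
        from ev eventually_at_right_real[OF d] show "eventually (\<lambda>\<tau>. dist (F \<tau> x) x < e) (at_right 0)"
        proof eventually_elim
          case (elim \<tau>)
          then have "norm ((F \<tau> ^^ 1) x - x) \<le> e / 2" by (intro elim(1)[rule_format]) auto
          with e show ?case by (simp add: dist_norm)
        qed
      qed
      from filterlim_compose[OF this step]
      have "((\<lambda>n. F (t / real n) x - x) \<longlongrightarrow> 0) \<F>" by (simp add: LIM_zero)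
      from tendsto_mult_right_zero[OF tendsto_norm_zero[OF this]] show ?thesis .
    qed
    have diff: "((\<lambda>n. V n (r + s) x - V n r (V n s x)) \<longlongrightarrow> 0) \<F>"
    proof (rule Lim_null_comparison[OF _ Fx])
      show "eventually (\<lambda>n. norm (V n (r + s) x - V n r (V n s x)) \<le> K * norm (F (t / real n) x - x)) \<F>"
        using ev1
      proof eventually_elim
        case (elim n)
        define p where "p = \<kappa> n r + \<kappa> n s"
        have eq: "real n * ((r + s) / t) = real n * (r / t) + real n * (s / t)"
          by (subst add_divide_distrib) (rule distrib_left)
        have nn: "real n * (r / t) \<ge> 0" "real n * (s / t) \<ge> 0" using rs t by simp_all
        have cases: "\<kappa> n (r + s) = p \<or> \<kappa> n (r + s) = Suc p"
          unfolding \<kappa>_def p_def eq using nn by (rule nat_floor_add)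
        have "real p * (t / real n) = real (\<kappa> n r) * (t / real n) + real (\<kappa> n s) * (t / real n)"
          by (simp only: p_def of_nat_add distrib_right)
        then have p: "real p * (t / real n) \<le> r + s"
          using \<kappa>[OF elim rs(1)] \<kappa>[OF elim rs(2)] by linarith
        have VV: "V n r (V n s x) = (F (t / real n) ^^ p) x"
          by (simp only: V_def p_def funpow_add o_apply)
        show ?case
        proof (cases "\<kappa> n (r + s) = p")
          case True
          then show ?thesis unfolding VV using K(1) by (simp add: V_def)
        next
          case False
          have lin: "linear (F (t / real n) ^^ p)" using t by (intro linear_F_funpow) simp
          have Suc: "\<kappa> n (r + s) = Suc p" using False cases by simp
          \<comment> \<open>The extra factor is taken innermost: it acts on the fixed x, and
            stability bounds the power outside.\<close>
          have "V n (r + s) x = (F (t / real n) ^^ p) (F (t / real n) x)"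
            by (simp only: V_def Suc funpow_Suc_right o_apply)
          then have "V n (r + s) x - V n r (V n s x) = (F (t / real n) ^^ p) (F (t / real n) x - x)"
            by (simp only: VV linear_diff[OF lin])
          then show ?thesis using K(2)[OF _ p] t by simp
        qed
      qed
    qed
    \<comment> \<open>The inner limit may be inserted first because the operators
      \<open>V n r\<close> are bounded uniformly in n.\<close>
    have "((\<lambda>n. V n r (V n s x)) \<longlongrightarrow> T r (T s x)) \<F>"
    proof -
      obtain K' where K': "\<And>n q x. n \<ge> 1 \<Longrightarrow> q \<in> {0..r} \<Longrightarrow> norm (V n q x) \<le> K' * norm x"
        using Vbound[of r] by blast
      have "((\<lambda>n. K' * norm (V n s x - T s x)) \<longlongrightarrow> 0) \<F>"
        by (rule tendsto_mult_right_zero[OF tendsto_norm_zero[OF LIM_zero[OF T[OF rs(2)]]]])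
      then have "((\<lambda>n. V n r (V n s x - T s x)) \<longlongrightarrow> 0) \<F>"
      proof (rule Lim_null_comparison[rotated])
        show "eventually (\<lambda>n. norm (V n r (V n s x - T s x)) \<le> K' * norm (V n s x - T s x)) \<F>"
          using ev1 by eventually_elim (use K' rs(1) in auto)
      qed
      from tendsto_add[OF this T[OF rs(1), of "T s x"]] show ?thesis
        by (simp add: linear_diff[OF linV])
    qed
    from tendsto_add[OF diff this]
    have "((\<lambda>n. V n (r + s) x) \<longlongrightarrow> T r (T s x)) \<F>" by simp
    then show ?thesis using rs by (intro tendsto_unique[OF \<F>(1) T]) auto
  qed
  have Tosc: "norm (T s x - x) \<le> e"
    if ev: "eventually (\<lambda>\<tau>. \<forall>m. real m * \<tau> \<le> d \<longrightarrow> (\<forall>z\<in>{x}. norm ((F \<tau> ^^ m) z - z) \<le> e)) (at_right 0)"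
      and s: "s \<in> {0..d}" for s d e x
  proof -
    have "eventually (\<lambda>n. norm (V n s x - x) \<le> e) \<F>"
      using eventually_compose_filterlim[OF ev step] ev1
    proof eventually_elim
      case (elim n)
      then show ?case using \<kappa>[of n s] s by (auto simp: V_def)
    qed
    then show ?thesis
      using s by (intro tendsto_upperbound[OF tendsto_norm[OF tendsto_diff[OF T tendsto_const]] _ \<F>(1)]) auto
  qed
  have c0: "c0_semigroup T"
    unfolding c0_semigroup_def
  proof (intro conjI allI impI)
    show "((\<lambda>s. T s x) \<longlongrightarrow> x) (at_right 0)" for x
    proof (rule tendstoI)
      fix e :: real assume e: "e > 0"
      obtain d where d: "d > 0"
        and ev: "eventually (\<lambda>\<tau>. \<forall>m. real m * \<tau> \<le> d \<longrightarrow> (\<forall>z\<in>{x}. norm ((F \<tau> ^^ m) z - z) \<le> e / 2)) (at_right 0)"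
        using uniform_osc[of "{x}" "e / 2"] e by auto
      show "eventually (\<lambda>s. dist (T s x) x < e) (at_right 0)"
        using eventually_at_right_real[OF d]
      proof eventually_elim
        case (elim s)
        then show ?case using Tosc[OF ev, of s] e by (simp add: dist_norm)
      qed
    qed
  qed (use linT T0 Tadd in auto)
  have "Map.graph L \<subseteq> Map.graph (generator T)"
  proof (rule subrelI)
    fix y z assume yz: "(y, z) \<in> Map.graph L"
    show "(y, z) \<in> Map.graph (generator T)"
    proof (rule generatorI_difference_le)
      fix e :: real assume e: "e > 0"
      obtain d where d: "d > 0"
        and ev: "eventually (\<lambda>\<tau>. \<forall>m. real m * \<tau> \<le> d \<longrightarrow> (\<forall>z\<in>{z}. norm ((F \<tau> ^^ m) z - z) \<le> e)) (at_right 0)"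
        using uniform_osc[of "{z}" e] e by auto
      \<comment> \<open>The slack e' of \<open>uniform_difference\<close> is not proportional to h,
        so it is sent to 0 while h stays fixed.\<close>
      have "norm (T h y - y - h *\<^sub>R z) \<le> h * e" if h: "h \<in> {0<..d}" for h
      proof (rule field_le_epsilon)
        fix e' :: real assume e': "e' > 0"
        have ev': "eventually (\<lambda>\<tau>. \<forall>m \<omega> y' z'. (y', z') \<in> {(y, z)} \<longrightarrow> real m * \<tau> \<le> h \<longrightarrow>
            (\<forall>j<m. norm ((F \<tau> ^^ j) z' - z') \<le> \<omega>) \<longrightarrow>
            norm ((F \<tau> ^^ m) y' - y' - (real m * \<tau>) *\<^sub>R z') \<le> real m * \<tau> * \<omega> + e') (at_right 0)"
          using yz h e' closure_subset[of "Map.graph L"] by (intro uniform_difference) auto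
        have le: "eventually (\<lambda>n. norm (V n h y - y - (real (\<kappa> n h) * (t / real n)) *\<^sub>R z)
            \<le> real (\<kappa> n h) * (t / real n) * e + e') \<F>"
          using eventually_compose_filterlim[OF ev step] eventually_compose_filterlim[OF ev' step] ev1
        proof eventually_elim
          case (elim n)
          have \<kappa>h: "real (\<kappa> n h) * (t / real n) \<le> h" using \<kappa>[OF elim(3)] h by simp
          show ?case
            unfolding V_def
          proof (rule elim(2)[rule_format])
            fix j assume "j < \<kappa> n h"
            then have "real j * (t / real n) \<le> d"
              using \<kappa>h h t by (intro order_trans[OF mult_right_mono[of "real j" "real (\<kappa> n h)"]]) auto
            then show "norm ((F (t / real n) ^^ j) z - z) \<le> e" using elim(1) by simp
          qed (use \<kappa>h in auto)
        qed
        show "norm (T h y - y - h *\<^sub>R z) \<le> h * e + e'"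
          by (rule tendsto_le[OF \<F>(1) _ _ le]; intro tendsto_intros T time) (use h in auto)
      qed
      with d show "\<exists>\<delta>>0. \<forall>h\<in>{0<..\<delta>}. norm (T h y - y - h *\<^sub>R z) \<le> h * e" by blast
    qed
  qed
  then have sub: "closure (Map.graph L) \<subseteq> Map.graph (generator T)"
    by (rule closure_minimal[OF _ closed_graph_generator[OF c0]])
  \<comment> \<open>By (a), g has the same limit along the filter as the discrete orbit; by (b), its
    images under \<open>L\<close> converge along a finer filter. The limiting pair lies in the
    closure of the graph.\<close>
  have orbit: "\<exists>z. (T s a, z) \<in> closure (Map.graph L)" if a: "a \<in> A" and s: "s \<ge> 0" for a s
  proof -
    obtain g where g: "\<And>n. n \<ge> 1 \<Longrightarrow> g n \<in> dom L"
      "(\<lambda>n. norm (V n s a - g n)) \<longlonglongrightarrow> 0" "precompact ((\<lambda>n. the (L (g n))) ` {1..})"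
      using approx[OF a, of "s / t"] s t by (auto simp: V_def \<kappa>_def)
    define u where "u n = the (L (g n))" for n
    have "((\<lambda>n. V n s a - g n) \<longlongrightarrow> 0) \<F>"
      by (rule filterlim_mono[OF tendsto_norm_zero_cancel[OF g(2)] order_refl \<F>(2)])
    from tendsto_diff[OF T[OF s, of a] this] have gT: "(g \<longlongrightarrow> T s a) \<F>" by simp
    have "compact (closure (u ` {1..}))" using g(3) by (simp add: precompact_def u_def)
    moreover have "eventually (\<lambda>n. u n \<in> closure (u ` {1..})) \<F>"
      using ev1 by eventually_elim (intro subsetD[OF closure_subset] imageI, simp)
    ultimately obtain \<G> z where \<G>: "\<G> \<noteq> bot" "\<G> \<le> \<F>" "(u \<longlongrightarrow> z) \<G>"
      using compact_convergent_subfilter[OF _ \<F>(1)] by metis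
    have "((\<lambda>n. (g n, u n)) \<longlongrightarrow> (T s a, z)) \<G>"
      using filterlim_mono[OF gT order_refl \<G>(2)] \<G>(3) by (rule tendsto_Pair)
    moreover have "eventually (\<lambda>n. (g n, u n) \<in> closure (Map.graph L)) \<G>"
      using filter_leD[OF \<G>(2) ev1]
    proof eventually_elim
      case (elim n)
      then have "(g n, u n) \<in> Map.graph L" using g(1) by (fastforce simp: u_def Map.graph_def)
      then show ?case using closure_subset by blast
    qed
    ultimately have "(T s a, z) \<in> closure (Map.graph L)"
      by (intro Lim_in_closed_set[OF closed_closure _ \<G>(1)]) auto
    then show ?thesis by blast
  qed
  have "Map.graph (generator T) \<subseteq> closure (Map.graph L)"
  proof (rule generator_subset_closed_subspace[OF c0 _ closed_closure A])
    show "subspace (closure (Map.graph L))"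
      using L unfolding linear_op_def by (rule subspace_closure)
    fix a assume a: "a \<in> A"
    \<comment> \<open>Time 0 of the preceding fact places a itself in the domain of the
      generator.\<close>
    obtain b where b: "(a, b) \<in> Map.graph (generator T)"
      using orbit[OF a, of 0] sub by (auto simp: T0)
    have "(T s a, T s b) \<in> closure (Map.graph L)" if s: "s \<ge> 0" for s
    proof -
      obtain z where z: "(T s a, z) \<in> closure (Map.graph L)" using orbit[OF a s] by blast
      \<comment> \<open>Both pairs lie in the graph of the generator, which is
        single-valued.\<close>
      moreover have "z = T s b"
        using subsetD[OF sub z] generator_semigroup_invariant[OF c0 s b] by (simp add: Map.graph_def)
      ultimately show ?thesis by simp
    qed
    with b show "\<exists>b. (a, b) \<in> Map.graph (generator T) \<and> (\<forall>s\<ge>0. (T s a, T s b) \<in> closure (Map.graph L))"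
      by blast
  qed
  with c0 sub show ?thesis by blast
qed

end

section \<open>The Trotter product formula\<close>

lemma map_eq_of_graph_eq:
  assumes "Map.graph A = Map.graph B"
  shows "A = B"
proof
  fix x
  have "(x, y) \<in> Map.graph A \<longleftrightarrow> (x, y) \<in> Map.graph B" for y using assms by simp
  then have eq: "A x = Some y \<longleftrightarrow> B x = Some y" for y by (simp add: Map.graph_def)
  show "A x = B x"
    using eq[of "the (A x)"] eq[of "the (B x)"] by (cases "A x"; cases "B x") simp_all
qed

lemma map_le_iff_graph: "A \<subseteq>\<^sub>m B \<longleftrightarrow> Map.graph A \<subseteq> Map.graph B"
proof
  assume "A \<subseteq>\<^sub>m B"
  then have "A x = Some y \<Longrightarrow> B x = Some y" for x y unfolding map_le_def by (metis domI)
  then show "Map.graph A \<subseteq> Map.graph B" unfolding Map.graph_def by blast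
next
  assume "Map.graph A \<subseteq> Map.graph B"
  then have "A x = Some y \<Longrightarrow> B x = Some y" for x y unfolding Map.graph_def by blast
  then show "A \<subseteq>\<^sub>m B" unfolding map_le_def by fastforce
qed

text \<open>The graph of a closed extension contains the closure of the graph, which is therefore
  single-valued; so the definite description in \<open>closure_op\<close> picks the right
  value.\<close>

lemma graph_closure_op:
  assumes "closable_op A"
  shows "Map.graph (closure_op A) = closure (Map.graph A)"
proof -
  obtain B where B: "closed (Map.graph B)" "A \<subseteq>\<^sub>m B"
    using assms by (auto simp: closable_op_def)
  then have sub: "closure (Map.graph A) \<subseteq> Map.graph B"
    by (intro closure_minimal) (simp_all add: map_le_iff_graph)
  have uniq: "y = y'" if "(x, y) \<in> closure (Map.graph A)" "(x, y') \<in> closure (Map.graph A)" for x y y'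
    using subsetD[OF sub that(1)] subsetD[OF sub that(2)] by (simp add: Map.graph_def)
  have the: "(THE y. (x, y) \<in> closure (Map.graph A)) = y" if "(x, y) \<in> closure (Map.graph A)" for x y
    using that uniq[OF _ that] by (rule the_equality)
  have "closure_op A x = Some y \<longleftrightarrow> (x, y) \<in> closure (Map.graph A)" for x y
  proof
    assume y: "closure_op A x = Some y"
    then obtain y' where y': "(x, y') \<in> closure (Map.graph A)"
      by (auto simp: closure_op_def split: if_splits)
    then have "closure_op A x = Some y'" using the[OF y'] by (auto simp: closure_op_def)
    with y y' show "(x, y) \<in> closure (Map.graph A)" by simp
  next
    assume "(x, y) \<in> closure (Map.graph A)"
    with the show "closure_op A x = Some y" by (auto simp: closure_op_def)
  qed
  then show ?thesis by (auto simp: Map.graph_def)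
qed

text \<open>The generator itself is the closed linear extension that closability asks for.\<close>

lemma closable_op_of_generator:
  assumes T: "c0_semigroup T" and G: "Map.graph (generator T) = closure (Map.graph A)"
  shows "closable_op A" and "closure_op A = generator T"
proof -
  show closable: "closable_op A"
    unfolding closable_op_def map_le_iff_graph
    using linear_op_generator[OF T]
    by (intro exI[of _ "generator T"]) (simp add: G closure_subset)
  show "closure_op A = generator T"
    by (rule map_eq_of_graph_eq) (simp add: G graph_closure_op[OF closable])
qed

lemma op_exp_generator:
  assumes "is_generator A"
  shows "c0_semigroup (op_exp A)" and "generator (op_exp A) = A"
  using someI_ex[OF assms[unfolded is_generator_def]] unfolding op_exp_def by simp_all

lemma graph_op_add:
  "Map.graph (op_add A B) = {(x, y + z) | x y z. (x, y) \<in> Map.graph A \<and> (x, z) \<in> Map.graph B}"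
  by (auto simp: op_add_def Map.graph_def split: if_splits)

lemma dom_op_add: "dom (op_add A B) = dom A \<inter> dom B"
  by (auto simp: op_add_def split: if_splits)

lemma linear_op_op_add:
  assumes "linear_op A" "linear_op B"
  shows "linear_op (op_add A B)"
  unfolding linear_op_def
proof (rule subspaceI)
  note A = assms(1)[unfolded linear_op_def] and B = assms(2)[unfolded linear_op_def]
  show "0 \<in> Map.graph (op_add A B)"
  proof -
    have "(0, 0) \<in> Map.graph A" "(0, 0) \<in> Map.graph B"
      using subspace_0[OF A] subspace_0[OF B] by (simp_all add: zero_prod_def)
    then have "(0, 0 + 0) \<in> Map.graph (op_add A B)" unfolding graph_op_add by blast
    then show ?thesis by (simp add: zero_prod_def)
  qed
  fix p q assume "p \<in> Map.graph (op_add A B)" "q \<in> Map.graph (op_add A B)"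
  then obtain x y z x' y' z' where *: "p = (x, y + z)" "q = (x', y' + z')"
    "(x, y) \<in> Map.graph A" "(x, z) \<in> Map.graph B" "(x', y') \<in> Map.graph A" "(x', z') \<in> Map.graph B"
    unfolding graph_op_add by blast
  have "p + q = (x + x', (y + y') + (z + z'))" by (simp add: *)
  moreover have "(x + x', y + y') \<in> Map.graph A" "(x + x', z + z') \<in> Map.graph B"
    using subspace_add[OF A *(3,5)] subspace_add[OF B *(4,6)] by simp_all
  ultimately show "p + q \<in> Map.graph (op_add A B)" unfolding graph_op_add by blast
next
  note A = assms(1)[unfolded linear_op_def] and B = assms(2)[unfolded linear_op_def]
  fix c p assume "p \<in> Map.graph (op_add A B)"
  then obtain x y z where *: "p = (x, y + z)" "(x, y) \<in> Map.graph A" "(x, z) \<in> Map.graph B"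
    unfolding graph_op_add by blast
  have "c *\<^sub>R p = (c *\<^sub>R x, c *\<^sub>R y + c *\<^sub>R z)" by (simp add: * scaleR_add_right)
  moreover have "(c *\<^sub>R x, c *\<^sub>R y) \<in> Map.graph A" "(c *\<^sub>R x, c *\<^sub>R z) \<in> Map.graph B"
    using subspace_scale[OF A *(2), of c] subspace_scale[OF B *(3), of c] by simp_all
  ultimately show "c *\<^sub>R p \<in> Map.graph (op_add A B)" unfolding graph_op_add by blast
qed

section \<open>The product of two semigroups as a Chernoff family\<close>

text \<open>S \<tau> (T \<tau> x) - x is the sum of S \<tau> x - x and S \<tau> (T \<tau> x - x). In
  the second term the quotient converges to z, and \<open>S \<tau>\<close> preserves this limit,
  being bounded near 0 and strongly continuous.\<close>

lemma product_difference_quotient: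
  fixes S T :: "real \<Rightarrow> 'a::banach \<Rightarrow> 'a"
  assumes S: "c0_semigroup S" and T: "c0_semigroup T"
    and y: "(x, y) \<in> Map.graph (generator S)" and z: "(x, z) \<in> Map.graph (generator T)"
  shows "((\<lambda>\<tau>. ((S \<tau> \<circ> T \<tau>) x - x) /\<^sub>R \<tau>) \<longlongrightarrow> y + z) (at_right 0)"
proof -
  obtain \<delta> K where \<delta>: "\<delta> > 0" and K: "\<And>s x. s \<in> {0..\<delta>} \<Longrightarrow> norm (S s x) \<le> K * norm x"
    using c0_semigroup_bounded_near_0[OF S] by metis
  have Sz: "((\<lambda>\<tau>. S \<tau> ((T \<tau> x - x) /\<^sub>R \<tau>)) \<longlongrightarrow> z) (at_right 0)"
  proof -
    have "((\<lambda>\<tau>. K * norm ((T \<tau> x - x) /\<^sub>R \<tau> - z)) \<longlongrightarrow> 0) (at_right 0)"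
      by (rule tendsto_mult_right_zero[OF tendsto_norm_zero[OF LIM_zero[OF z[unfolded graph_generator]]]])
    then have "((\<lambda>\<tau>. S \<tau> ((T \<tau> x - x) /\<^sub>R \<tau> - z)) \<longlongrightarrow> 0) (at_right 0)"
    proof (rule Lim_null_comparison[rotated])
      show "eventually (\<lambda>\<tau>. norm (S \<tau> ((T \<tau> x - x) /\<^sub>R \<tau> - z)) \<le> K * norm ((T \<tau> x - x) /\<^sub>R \<tau> - z)) (at_right 0)"
        using eventually_at_right_real[OF \<delta>] by eventually_elim (intro K, simp)
    qed
    from tendsto_add[OF this c0_semigroup_tendsto[OF S, of z]]
    have "((\<lambda>\<tau>. S \<tau> ((T \<tau> x - x) /\<^sub>R \<tau> - z) + S \<tau> z) \<longlongrightarrow> z) (at_right 0)" by simp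
    then show ?thesis
      by (rule Lim_transform_eventually, intro eventually_mono[OF eventually_at_right_less])
         (simp add: linear_simps[OF c0_semigroup_linear[OF S]])
  qed
  from tendsto_add[OF y[unfolded graph_generator] Sz] show ?thesis
    by (rule Lim_transform_eventually, intro eventually_mono[OF eventually_at_right_less])
       (simp add: linear_simps[OF c0_semigroup_linear[OF S]] scaleR_diff_right)
qed

lemma chernoff_family_product:
  fixes C D :: "'a::banach \<rightharpoonup> 'a"
  assumes C: "is_generator C" and D: "is_generator D"
    and dense: "closure (dom C \<inter> dom D) = UNIV"
    and M: "M \<ge> 1" and stable: "\<And>n m s. n \<ge> (1::nat) \<Longrightarrow> m \<ge> (1::nat) \<Longrightarrow> s \<ge> 0 \<Longrightarrow>
      onorm ((op_exp C (s / real n) \<circ> op_exp D (s / real n)) ^^ m) \<le> M * exp (a * s * (real m / real n))"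
  shows "chernoff_family (\<lambda>\<tau>. op_exp C \<tau> \<circ> op_exp D \<tau>) (op_add C D)"
proof (rule chernoff_family.intro)
  note SC = op_exp_generator[OF C] and SD = op_exp_generator[OF D]
  have lin: "bounded_linear ((op_exp C \<tau> \<circ> op_exp D \<tau>) ^^ m)" if "\<tau> \<ge> 0" for \<tau> m
  proof (induction m)
    case 0
    then show ?case by (simp add: id_def bounded_linear_ident)
  next
    case (Suc m)
    then show ?case
      using bounded_linear_compose[OF bounded_linear_compose[OF c0_semigroup_linear[OF SC(1) that]
            c0_semigroup_linear[OF SD(1) that]] Suc]
      by (simp add: o_def)
  qed
  show "bounded_linear (op_exp C \<tau> \<circ> op_exp D \<tau>)" if "\<tau> \<ge> 0" for \<tau>
    using lin[OF that, of 1] by simp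
  show "\<exists>K\<ge>1. \<forall>\<tau>\<ge>0. \<forall>m x. real m * \<tau> \<le> S \<longrightarrow>
          norm (((op_exp C \<tau> \<circ> op_exp D \<tau>) ^^ m) x) \<le> K * norm x" for S
  \<comment> \<open>The stability hypothesis is used with n = 1 and s = \<tau>. The absolute values
    keep the constant at least 1 for all signs of a and S, which also settles m = 0, where that
    hypothesis does not apply.\<close>
  proof (intro exI[of _ "M * exp (\<bar>a\<bar> * \<bar>S\<bar>)"] conjI allI impI)
    have K1: "1 * 1 \<le> M * exp (\<bar>a\<bar> * \<bar>S\<bar>)" using M by (intro mult_mono) auto
    then show "1 \<le> M * exp (\<bar>a\<bar> * \<bar>S\<bar>)" by simp
    fix \<tau> m x assume \<tau>: "\<tau> \<ge> 0" and mS: "real m * \<tau> \<le> S"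
    show "norm (((op_exp C \<tau> \<circ> op_exp D \<tau>) ^^ m) x) \<le> M * exp (\<bar>a\<bar> * \<bar>S\<bar>) * norm x"
    proof (cases "m = 0")
      case True
      then show ?thesis using mult_right_mono[OF K1, of "norm x"] by simp
    next
      case False
      have "a * (real m * \<tau>) \<le> \<bar>a\<bar> * \<bar>S\<bar>"
        using \<tau> mS by (intro mult_mono) auto
      then have "M * exp (a * \<tau> * (real m / real 1)) \<le> M * exp (\<bar>a\<bar> * \<bar>S\<bar>)"
        using M by (simp add: ac_simps)
      then have "onorm ((op_exp C \<tau> \<circ> op_exp D \<tau>) ^^ m) \<le> M * exp (\<bar>a\<bar> * \<bar>S\<bar>)"
        using stable[of 1 m \<tau>] False \<tau> by simp
      then show ?thesis
        using onorm[OF lin[OF \<tau>, of m], of x] by (meson mult_right_mono norm_ge_zero order_trans)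
    qed
  qed
  show "closure (dom (op_add C D)) = UNIV" using dense by (simp add: dom_op_add)
  show "((\<lambda>\<tau>. ((op_exp C \<tau> \<circ> op_exp D \<tau>) y - y) /\<^sub>R \<tau>) \<longlongrightarrow> z) (at_right 0)"
    if yz: "(y, z) \<in> Map.graph (op_add C D)" for y z
  proof -
    obtain u v where "z = u + v" "(y, u) \<in> Map.graph C" "(y, v) \<in> Map.graph D"
      using yz unfolding graph_op_add by blast
    then show ?thesis
      using product_difference_quotient[OF SC(1) SD(1)] SC(2) SD(2) by simp
  qed
qed

lemma precompact_convergent_sequence:
  fixes u :: "nat \<Rightarrow> 'a::metric_space"
  assumes "u \<longlonglongrightarrow> l"
  shows "precompact (u ` {1..})"
proof -
  have K: "compact (insert l (range u))"
    using compactin_sequence_with_limit[of euclidean u l "range u"] assms by simp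
  then have "closure (u ` {1..}) \<subseteq> insert l (range u)"
    by (intro closure_minimal compact_imp_closed) auto
  with compact_Int_closed[OF K closed_closure, of "u ` {1..}"] show ?thesis
    unfolding precompact_def by (simp add: Int_absorb1)
qed

lemma domain_sequence_approximation:
  fixes L :: "'a::metric_space \<rightharpoonup> 'b::metric_space"
  assumes "(x, z) \<in> closure (Map.graph L)"
  shows "\<exists>g :: nat \<Rightarrow> 'a.
    (\<forall>n. g n \<in> dom L) \<and> g \<longlonglongrightarrow> x \<and> (\<lambda>n. the (L (g n))) \<longlonglongrightarrow> z"
proof -
  obtain p where p: "\<And>n. p n \<in> Map.graph L" "p \<longlonglongrightarrow> (x, z)"
    using assms unfolding closure_sequential by blast
  have L: "L (fst (p n)) = Some (snd (p n))" for n
    using p(1)[of n] by (auto simp: Map.graph_def)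
  show ?thesis
    using tendsto_fst[OF p(2)] tendsto_snd[OF p(2)]
    by (intro exI[of _ "\<lambda>n. fst (p n)"]) (auto simp: L)
qed

theorem corollary5p2:
  fixes C D :: "'a::banach \<rightharpoonup> 'a" and t :: real
  assumes "t > 0"
    and "is_generator C" and "is_generator D"
    and "closure (dom C \<inter> dom D) = UNIV"
    and "\<exists>(a::real) (M::real). M \<ge> 1 \<and>
           (\<forall>n\<ge>(1::nat). \<forall>m\<ge>(1::nat). \<forall>s\<ge>(0::real).
              onorm ((op_exp C (s / real n) \<circ> op_exp D (s / real n)) ^^ m)
                \<le> M * exp (a * s * (real m / real n)))"
  shows "((closable_op (op_add C D) \<and> is_generator (closure_op (op_add C D)))
            \<longleftrightarrow> (\<exists>A. approximating_subspace t C D A)) \<and>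
         ((\<exists>A. approximating_subspace t C D A) \<longrightarrow>
            (\<forall>s>0. \<forall>f. (\<lambda>n. ((op_exp C (s / real n) \<circ> op_exp D (s / real n)) ^^ n) f)
               \<longlonglongrightarrow> op_exp (closure_op (op_add C D)) s f))"
proof -
  let ?L = "op_add C D"
  let ?E = "op_exp (closure_op ?L)"
  obtain a M where "M \<ge> 1" and "\<And>n m s. n \<ge> (1::nat) \<Longrightarrow> m \<ge> (1::nat) \<Longrightarrow> s \<ge> 0 \<Longrightarrow>
      onorm ((op_exp C (s / real n) \<circ> op_exp D (s / real n)) ^^ m) \<le> M * exp (a * s * (real m / real n))"
    using assms(5) by blast
  then interpret chernoff_family "\<lambda>\<tau>. op_exp C \<tau> \<circ> op_exp D \<tau>" ?L
    by (rule chernoff_family_product[OF assms(2-4)])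
  have lin: "linear_op ?L"
    using linear_op_generator[OF op_exp_generator(1)[OF assms(2)]]
      linear_op_generator[OF op_exp_generator(1)[OF assms(3)]]
    by (simp add: op_exp_generator(2) assms linear_op_op_add)
  have E: "c0_semigroup ?E" "Map.graph (generator ?E) = closure (Map.graph ?L)"
    if "closable_op ?L" "is_generator (closure_op ?L)"
    using op_exp_generator[OF that(2)] graph_closure_op[OF that(1)] by simp_all
  have approximating: "approximating_subspace t C D (dom C \<inter> dom D)"
    if "closable_op ?L" "is_generator (closure_op ?L)"
    unfolding approximating_subspace_def
  proof (intro conjI ballI allI impI)
    note G = E[OF that]
    have "dom C \<inter> dom D = fst ` Map.graph ?L" by (simp add: fst_graph_eq_dom dom_op_add)
    also have "subspace \<dots>"
      using lin unfolding linear_op_def by (intro linear_subspace_image) (auto intro: linearI)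
    finally show "subspace (dom C \<inter> dom D)" .
    fix f s assume f: "f \<in> dom C \<inter> dom D" and s: "(s::real) \<ge> 0"
    have "(f, the (?L f)) \<in> Map.graph ?L"
      using f by (auto simp: Map.graph_def op_add_def)
    then have "(f, the (?L f)) \<in> Map.graph (generator ?E)"
      using G(2) closure_subset by blast
    \<comment> \<open>[n s] factors of step t / n act for a time close to s * t, so this is the
      limit of the discrete orbit.\<close>
    then have "(?E (s * t) f, ?E (s * t) (the (?L f))) \<in> closure (Map.graph ?L)"
      using generator_semigroup_invariant[OF G(1)] s assms(1) G(2) by auto
    \<comment> \<open>The sequence approximates the limit and not the individual orbit terms. Then
      (a) holds because both sequences have the same limit, and (b) because convergent sequences are
      precompact.\<close>
    from domain_sequence_approximation[OF this] obtain g where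
      g: "\<And>n. g n \<in> dom ?L" "g \<longlonglongrightarrow> ?E (s * t) f"
      and Lg: "(\<lambda>n. the (?L (g n))) \<longlonglongrightarrow> ?E (s * t) (the (?L f))" by blast
    have "(\<lambda>n. real (nat \<lfloor>real n * s\<rfloor>) * (t / real n)) \<longlonglongrightarrow> s * t"
      using tendsto_time[of t "s * t"] assms(1) s by simp
    from chernoff_tendsto[OF G filterlim_step[OF assms(1)] this, of f]
    have "(\<lambda>n. ((op_exp C (t / real n) \<circ> op_exp D (t / real n)) ^^ nat \<lfloor>real n * s\<rfloor>) f - g n) \<longlonglongrightarrow> 0"
      using tendsto_diff[OF _ g(2)] by fastforce
    then show "\<exists>g :: nat \<Rightarrow> 'a.
        (\<forall>n\<ge>1. g n \<in> dom C \<inter> dom D) \<and>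
        (\<lambda>n. norm (((op_exp C (t / real n) \<circ> op_exp D (t / real n)) ^^ nat \<lfloor>real n * s\<rfloor>) f - g n))
          \<longlonglongrightarrow> 0 \<and>
        precompact (g ` {1..}) \<and>
        precompact ((\<lambda>n. the (op_add C D (g n))) ` {1..})"
      using g Lg by (intro exI[of _ g] conjI precompact_convergent_sequence tendsto_norm_zero)
        (auto simp: dom_op_add)
  qed (use assms(4) in auto)
  have generates: "closable_op ?L \<and> is_generator (closure_op ?L)"
    if A: "approximating_subspace t C D A" for A
  proof -
    have "\<exists>T. c0_semigroup T \<and> Map.graph (generator T) = closure (Map.graph ?L)"
      using A assms(1) lin unfolding approximating_subspace_def dom_op_add[symmetric]
      by (intro semigroup_of_precompact_orbits[of t A]) auto
    then obtain T where "c0_semigroup T" "Map.graph (generator T) = closure (Map.graph ?L)" by blast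
    from closable_op_of_generator[OF this] this(1) show ?thesis by (auto simp: is_generator_def)
  qed
  have "(\<lambda>n. ((op_exp C (s / real n) \<circ> op_exp D (s / real n)) ^^ n) f) \<longlonglongrightarrow> ?E s f"
    if "closable_op ?L" "is_generator (closure_op ?L)" "s > 0" for s f
  proof (rule chernoff_tendsto[OF E[OF that(1,2)] filterlim_step[OF that(3)]])
    show "(\<lambda>n. real n * (s / real n)) \<longlonglongrightarrow> s"
      \<comment> \<open>The total time equals s only from n = 1 on; at n = 0 it is 0.\<close>
      by (rule Lim_transform_eventually[OF tendsto_const], rule eventually_sequentiallyI[of 1]) simp
  qed
  with approximating generates show ?thesis by blast
qed

end
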